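(* Let $E$ be the elliptic curve defined by $y^2=x^3+2x^2-1$, with the unique point at infinity as basepoint. Then every hyperbolic Dehn surgery point on $E$ (of the knot $7_4$) has infinite order in the Mordell-Weil group of $E$, i.e. it is not a torsion point of $E(\overline{\mathbf{Q}})$.
   Context: $K=7_4$ is the two-bridge knot $(15,11)$ in $S^3$. Its knot group is $\Gamma=\pi_1(S^3\setminus K)=\langle a,b\mid aw^2=w^2b\rangle$ with $w=ab^{-1}ab^{-1}a^{-1}ba^{-1}b$, where $a,b$ are meridians. $X(\Gamma)$ is the $\mathrm{SL}_2(\mathbf{C})$-character variety of $\Gamma$, and its canonical component $C$ is the irreducible component containing the character of the discrete faithful representation. In the coordinates $Z=\chi_\rho(a)=\chi_\rho(b)$, $R=\chi_\rho(ab^{-1})$, $C$ is the affine curve $R^3-R^2Z^2+2R^2-1=0$. The birational map $C\dashrightarrow E$ is $(R,Z)\mapsto(x,y)=(R,RZ)$ (inverse $R=x$, $Z=y/x$). Dehn surgery: for coprime integers $(p,q)$ the $(p,q)$ Dehn surgery $N$ is the closed manifold obtained by filling the knot exterior along the slope $p/q$; for $d\ge 2$ the $(d,0)$ Dehn surgery $N$ is the closed orbifold with underlying space $S^3$ and singular locus $K$ with cone angle $2\pi/d$. It is hyperbolic if $N$ admits a complete hyperbolic structure. To a hyperbolic Dehn surgery $N$ one associates a representation $\rho:\Gamma\to\mathrm{SL}_2(\mathbf{C})$ lifting the composite of $\Gamma\to\pi_1^{\mathrm{orb}}(N)$ with the discrete faithful holonomy $\pi_1^{\mathrm{orb}}(N)\to\mathrm{PSL}_2(\mathbf{C})$,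 whose character lies on $C$. A hyperbolic Dehn surgery point on $C$ is the character $(R,Z)$ of such a $\rho$; a hyperbolic Dehn surgery point on $E$ is the image of such a point under the map $C\dashrightarrow E$. It is a rational point of $E$ over the trace field $\mathbf{Q}(\operatorname{tr}\rho(\gamma):\gamma\in\Gamma)$. *)

theory Defs
  imports "HOL-Analysis.Analysis" "HOL-Algebra.Generated_Groups"
begin

section \<open>The group of the knot \<open>7\<^sub>4\<close>\<close>

datatype knot_gen = Gen_a | Gen_b

text \<open>A letter \<open>(g, e)\<close> stands for the generator \<open>g\<close> if \<open>e\<close> holds and for its inverse otherwise.\<close>

type_synonym word = "(knot_gen \<times> bool) list"

abbreviation la :: "knot_gen \<times> bool" where "la \<equiv> (Gen_a, True)"
abbreviation lA :: "knot_gen \<times> bool" where "lA \<equiv> (Gen_a, False)"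
abbreviation lb :: "knot_gen \<times> bool" where "lb \<equiv> (Gen_b, True)"
abbreviation lB :: "knot_gen \<times> bool" where "lB \<equiv> (Gen_b, False)"

definition knot_w :: word where
  "knot_w = [la, lB, la, lB, lA, lb, lA, lb]"

text \<open>Equality of words in the group \<open>\<langle>a, b | a w\<^sup>2 = w\<^sup>2 b\<rangle>\<close>.\<close>

inductive knot_eq :: "word \<Rightarrow> word \<Rightarrow> bool" where
  refl: "knot_eq u u"
| sym: "knot_eq u v \<Longrightarrow> knot_eq v u"
| trans: "knot_eq u v \<Longrightarrow> knot_eq v x \<Longrightarrow> knot_eq u x"
| append: "knot_eq u u' \<Longrightarrow> knot_eq v v' \<Longrightarrow> knot_eq (u @ v) (u' @ v')"
| cancel: "knot_eq [(g, e), (g, \<not> e)] []"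
| relation: "knot_eq ([la] @ knot_w @ knot_w) (knot_w @ knot_w @ [lb])"

definition word_class :: "word \<Rightarrow> word set" where
  "word_class u = {v. knot_eq u v}"

definition knot_group :: "word set monoid" where
  "knot_group = \<lparr> carrier = range word_class,
     mult = (\<lambda>U V. {x. \<exists>u\<in>U. \<exists>v\<in>V. knot_eq (u @ v) x}),
     one = word_class [] \<rparr>"

definition meridian :: "word set" where
  "meridian = word_class [la]"

text \<open>The longitude commuting with the meridian \<open>a\<close>: with \<open>v = w\<^sup>2\<close> and \<open>v*\<close> the word \<open>v\<close> read
  backwards, \<open>v b = a v\<close> and \<open>v* a = b v*\<close>, so \<open>v v*\<close> commutes with \<open>a\<close>; its exponent sum is \<open>0\<close>.\<close>

definition longitude :: "word set" where
  "longitude = word_class (knot_w @ knot_w @ rev (knot_w @ knot_w))"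

section \<open>Dehn surgeries\<close>

definition normal_closure :: "('a, 'b) monoid_scheme \<Rightarrow> 'a set \<Rightarrow> 'a set" where
  "normal_closure G S =
     generate G {g \<otimes>\<^bsub>G\<^esub> s \<otimes>\<^bsub>G\<^esub> inv\<^bsub>G\<^esub> g | g s. g \<in> carrier G \<and> s \<in> S}"

definition manifold_coeffs :: "int \<Rightarrow> int \<Rightarrow> bool" where
  "manifold_coeffs p q \<longleftrightarrow> coprime p q"

definition orbifold_coeffs :: "int \<Rightarrow> int \<Rightarrow> bool" where
  "orbifold_coeffs p q \<longleftrightarrow> p \<ge> 2 \<and> q = 0"

text \<open>The kernel of \<open>\<Gamma> \<rightarrow> \<pi>\<^sub>1\<^sup>o\<^sup>r\<^sup>b(N)\<close> for the \<open>(p,q)\<close> surgery \<open>N\<close>. For \<open>(d,0)\<close> it is normally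
  generated by the \<open>d\<close>-th power of the meridian, as it should be for cone angle \<open>2\<pi>/d\<close>.\<close>

definition surgery_kernel :: "int \<Rightarrow> int \<Rightarrow> word set set" where
  "surgery_kernel p q = normal_closure knot_group
     {(meridian [^]\<^bsub>knot_group\<^esub> p) \<otimes>\<^bsub>knot_group\<^esub> (longitude [^]\<^bsub>knot_group\<^esub> q)}"

definition surgery_group :: "int \<Rightarrow> int \<Rightarrow> word set set monoid" where
  "surgery_group p q = knot_group Mod surgery_kernel p q"

definition surgery_proj :: "int \<Rightarrow> int \<Rightarrow> word set \<Rightarrow> word set set" where
  "surgery_proj p q g = surgery_kernel p q #>\<^bsub>knot_group\<^esub> g"

section \<open>\<open>SL\<^sub>2(C)\<close>, \<open>PSL\<^sub>2(C)\<close> and hyperbolic space\<close>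

type_synonym mat2 = "complex ^ 2 ^ 2"

definition SL2C :: "mat2 monoid" where
  "SL2C = \<lparr> carrier = {A. det A = 1}, mult = (**), one = mat 1 \<rparr>"

definition pm_one :: "mat2 set" where
  "pm_one = {mat 1, - mat 1}"

definition PSL2C :: "mat2 set monoid" where
  "PSL2C = SL2C Mod pm_one"

text \<open>Upper half-space; \<open>(z, t)\<close> is the point at height \<open>t\<close> above \<open>z\<close>.\<close>

definition H3 :: "(complex \<times> real) set" where
  "H3 = {(z, t). t > 0}"

text \<open>The Poincare extension of a Moebius transformation, which identifies \<open>PSL\<^sub>2(C)\<close> with the
  orientation-preserving isometries of \<open>H\<^sup>3\<close>.\<close>

definition SL2C_act :: "mat2 \<Rightarrow> complex \<times> real \<Rightarrow> complex \<times> real" where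
  "SL2C_act A = (\<lambda>(z, t).
     let a = A $ 1 $ 1; b = A $ 1 $ 2; c = A $ 2 $ 1; d = A $ 2 $ 2;
         n = (cmod (c * z + d))\<^sup>2 + (cmod c)\<^sup>2 * t\<^sup>2
     in (((a * z + b) * cnj (c * z + d) + a * cnj c * of_real (t\<^sup>2)) / of_real n, t / n))"

text \<open>The choice of the lift is immaterial, since \<open>A\<close> and \<open>-A\<close> act in the same way.\<close>

definition PSL2C_act :: "mat2 set \<Rightarrow> complex \<times> real \<Rightarrow> complex \<times> real" where
  "PSL2C_act X = SL2C_act (SOME A. A \<in> X)"

section \<open>Hyperbolic Dehn surgeries and their points\<close>

definition isotropy :: "int \<Rightarrow> int \<Rightarrow> (word set set \<Rightarrow> mat2 set) \<Rightarrow> complex \<times> real \<Rightarrow> word set set set" where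
  "isotropy p q h x = {g \<in> carrier (surgery_group p q). PSL2C_act (h g) x = x}"

text \<open>A hyperbolic structure \<open>N \<cong> H\<^sup>3/\<pi>\<^sub>1\<^sup>o\<^sup>r\<^sup>b(N)\<close> through its holonomy \<open>h\<close>: a faithful representation
  with discrete image and compact quotient. Since \<open>SL\<^sub>2(C) \<rightarrow> PSL\<^sub>2(C)\<close> is a two-fold covering, the
  image is discrete iff its preimage in \<open>SL\<^sub>2(C)\<close> is; that preimage is the union of the cosets.
  The isotropy groups are those of \<open>N\<close>: trivial if \<open>N\<close> is a manifold; for the \<open>(d,0)\<close> orbifold
  trivial off the singular locus and conjugate to the group generated by the meridian on it,
  where the meridian is a rotation through \<open>2\<pi>/d\<close>, i.e. has trace \<open>\<plusminus>2 cos(\<pi>/d)\<close>.\<close>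

definition hyperbolic_holonomy :: "int \<Rightarrow> int \<Rightarrow> (word set set \<Rightarrow> mat2 set) \<Rightarrow> bool" where
  "hyperbolic_holonomy p q h \<longleftrightarrow>
     h \<in> hom (surgery_group p q) PSL2C \<and>
     inj_on h (carrier (surgery_group p q)) \<and>
     discrete (\<Union> (h ` carrier (surgery_group p q))) \<and>
     (\<exists>D. compact D \<and> D \<subseteq> H3 \<and>
        (\<Union>g\<in>carrier (surgery_group p q). PSL2C_act (h g) ` D) = H3) \<and>
     (manifold_coeffs p q \<longrightarrow> (\<forall>x\<in>H3. isotropy p q h x = {\<one>\<^bsub>surgery_group p q\<^esub>})) \<and>
     (orbifold_coeffs p q \<longrightarrow>
        (\<forall>x\<in>H3. isotropy p q h x = {\<one>\<^bsub>surgery_group p q\<^esub>} \<or>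
           (\<exists>g\<in>carrier (surgery_group p q). isotropy p q h x =
              {g \<otimes>\<^bsub>surgery_group p q\<^esub> y \<otimes>\<^bsub>surgery_group p q\<^esub> inv\<^bsub>surgery_group p q\<^esub> g | y.
                 y \<in> generate (surgery_group p q) {surgery_proj p q meridian}})) \<and>
        (\<forall>A \<in> h (surgery_proj p q meridian). (trace A)\<^sup>2 = (of_real (2 * cos (pi / p)))\<^sup>2))"

text \<open>The canonical component, in the coordinates \<open>R = tr \<rho>(ab\<inverse>)\<close> and \<open>Z = tr \<rho>(a)\<close>.\<close>

definition canonical_curve :: "(complex \<times> complex) set" where
  "canonical_curve = {(R, Z). R ^ 3 - R\<^sup>2 * Z\<^sup>2 + 2 * R\<^sup>2 - 1 = 0}"

definition char_point :: "(word set \<Rightarrow> mat2) \<Rightarrow> complex \<times> complex" where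
  "char_point \<rho> = (trace (\<rho> (word_class [la, lB])), trace (\<rho> (word_class [la])))"

definition hyperbolic_surgery_rep :: "int \<Rightarrow> int \<Rightarrow> (word set \<Rightarrow> mat2) \<Rightarrow> bool" where
  "hyperbolic_surgery_rep p q \<rho> \<longleftrightarrow>
     \<rho> \<in> hom knot_group SL2C \<and>
     (\<exists>h. hyperbolic_holonomy p q h \<and>
        (\<forall>g\<in>carrier knot_group. pm_one #>\<^bsub>SL2C\<^esub> \<rho> g = h (surgery_proj p q g))) \<and>
     char_point \<rho> \<in> canonical_curve"

definition surgery_points_C :: "(complex \<times> complex) set" where
  "surgery_points_C = {char_point \<rho> | \<rho> p q.
     (manifold_coeffs p q \<or> orbifold_coeffs p q) \<and> hyperbolic_surgery_rep p q \<rho>}"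

section \<open>The elliptic curve \<open>y\<^sup>2 = x\<^sup>3 + 2x\<^sup>2 - 1\<close>\<close>

datatype ec_point = Infinity | Affine complex complex

fun ec_add :: "ec_point \<Rightarrow> ec_point \<Rightarrow> ec_point" where
  "ec_add Infinity P = P"
| "ec_add P Infinity = P"
| "ec_add (Affine x1 y1) (Affine x2 y2) =
     (if x1 = x2 \<and> y1 = - y2 then Infinity
      else let m = (if x1 = x2 then (3 * x1\<^sup>2 + 4 * x1) / (2 * y1) else (y2 - y1) / (x2 - x1));
               x3 = m\<^sup>2 - 2 - x1 - x2
           in Affine x3 (m * (x1 - x3) - y1))"

definition ec_group :: "complex set \<Rightarrow> ec_point monoid" where
  "ec_group K = \<lparr> carrier = {Infinity} \<union>
       {Affine x y | x y. x \<in> K \<and> y \<in> K \<and> y\<^sup>2 = x ^ 3 + 2 * x\<^sup>2 - 1},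
     mult = ec_add, one = Infinity \<rparr>"

definition Qbar :: "complex set" where
  "Qbar = {z. algebraic z}"

definition infinite_order_in :: "('a, 'b) monoid_scheme \<Rightarrow> 'a \<Rightarrow> bool" where
  "infinite_order_in G P \<longleftrightarrow> P \<in> carrier G \<and> (\<forall>n::nat. n > 0 \<longrightarrow> P [^]\<^bsub>G\<^esub> n \<noteq> \<one>\<^bsub>G\<^esub>)"

text \<open>The birational map from the canonical component to the elliptic curve; it is regular on the
  whole affine curve.\<close>

definition C_to_E :: "complex \<times> complex \<Rightarrow> ec_point" where
  "C_to_E = (\<lambda>(R, Z). Affine R (R * Z))"

definition surgery_points_E :: "ec_point set" where
  "surgery_points_E = C_to_E ` surgery_points_C"

end

theory Submission
  imports Defs
begin

text \<open>Let \<open>P = (R, R Z)\<close> be the point of a surgery representation \<open>\<rho>\<close>, and consider a valuation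
  ring of the complex numbers. If \<open>R\<close> lies in its maximal ideal, then \<open>Z\<^sup>2 = R + 2 - R\<^sup>-\<^sup>2\<close> has a
  pole, hence so has an eigenvalue of the meridian, whereas the eigenvalue of the longitude is
  congruent to \<open>1\<close>. The surgery relation \<open>\<rho>(m)\<^sup>p \<rho>(l)\<^sup>q = \<plusminus>1\<close> then forces \<open>p = 0\<close>, \<open>q = \<plusminus>1\<close> and
  \<open>\<rho>(l) = \<plusminus>1\<close>, which only happens for \<open>R = 2\<close> and \<open>R\<^sup>2 = 2\<close>; there \<open>\<rho>\<close> takes elliptic values, which is
  impossible for a closed hyperbolic manifold. So \<open>1/R\<close> is integral at every valuation ring, and
  in particular \<open>R\<close> is algebraic. On the other hand, at a place above \<open>2\<close> every affine torsion
  point of \<open>E\<close> that is not of order \<open>2\<close> has its abscissa in the maximal ideal. The points of order \<open>2\<close>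
  are those with \<open>Z = 0\<close>, where \<open>\<rho>\<close> is dihedral and so not a hyperbolic holonomy.\<close>

section \<open>Valuation rings\<close>

locale unital_subring =
  fixes A :: "'a :: field set"
  assumes one_closed: "1 \<in> A"
    and diff_closed: "x \<in> A \<Longrightarrow> y \<in> A \<Longrightarrow> x - y \<in> A"
    and mult_closed: "x \<in> A \<Longrightarrow> y \<in> A \<Longrightarrow> x * y \<in> A"
begin

lemma zero_closed: "0 \<in> A"
  using diff_closed[OF one_closed one_closed] by simp

lemma uminus_closed: "x \<in> A \<Longrightarrow> - x \<in> A"
  using diff_closed[OF zero_closed] by fastforce

lemma add_closed: "x \<in> A \<Longrightarrow> y \<in> A \<Longrightarrow> x + y \<in> A"
  using diff_closed[of x "- y"] uminus_closed by simp

lemma power_closed: "x \<in> A \<Longrightarrow> x ^ n \<in> A"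
  by (induction n) (auto intro: one_closed mult_closed)

lemma numeral_closed: "numeral n \<in> A"
proof -
  have "of_nat k \<in> A" for k
    by (induction k) (auto intro: zero_closed one_closed add_closed)
  from this[of "numeral n"] show ?thesis by simp
qed

lemma sum_closed: "(\<And>i. i \<in> I \<Longrightarrow> f i \<in> A) \<Longrightarrow> sum f I \<in> A"
  by (induction I rule: infinite_finite_induct) (auto intro: zero_closed add_closed)

lemmas closed = zero_closed one_closed numeral_closed uminus_closed add_closed diff_closed
  mult_closed power_closed

end

text \<open>The ring \<open>A[x]\<close>. As \<open>A\<close> is a set and not a type, its
  polynomials are those over the whole field with every coefficient in \<open>A\<close>.\<close>

definition adjoin :: "'a :: field set \<Rightarrow> 'a \<Rightarrow> 'a set" where
  "adjoin A x = {poly q x | q. \<forall>i. coeff q i \<in> A}"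

context unital_subring
begin

lemma subset_adjoin: "A \<subseteq> adjoin A x"
proof
  fix a assume "a \<in> A"
  then have "\<forall>i. coeff [:a:] i \<in> A" by (auto simp: coeff_pCons zero_closed split: nat.splits)
  then show "a \<in> adjoin A x" unfolding adjoin_def by (auto intro!: exI[of _ "[:a:]"])
qed

lemma mem_adjoin: "x \<in> adjoin A x"
proof -
  have "\<forall>i. coeff [:0, 1:] i \<in> A"
    by (auto simp: coeff_pCons zero_closed one_closed split: nat.splits)
  then show ?thesis unfolding adjoin_def by (auto intro!: exI[of _ "[:0, 1:]"])
qed

lemma unital_subring_adjoin: "unital_subring (adjoin A x)"
proof
  show "1 \<in> adjoin A x" using subset_adjoin one_closed by auto
next
  fix y z assume "y \<in> adjoin A x" "z \<in> adjoin A x"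
  then obtain p q where "\<forall>i. coeff p i \<in> A" "y = poly p x" "\<forall>i. coeff q i \<in> A" "z = poly q x"
    unfolding adjoin_def by auto
  then have "\<forall>i. coeff (p - q) i \<in> A" "y - z = poly (p - q) x"
      "\<forall>i. coeff (p * q) i \<in> A" "y * z = poly (p * q) x"
    by (auto simp: coeff_mult intro: diff_closed sum_closed mult_closed)
  then show "y - z \<in> adjoin A x" "y * z \<in> adjoin A x"
    unfolding adjoin_def by blast+
qed

end

locale valuation_ring = unital_subring A for A :: "'a :: field set" +
  assumes total: "x \<in> A \<or> inverse x \<in> A"
begin

text \<open>Here \<open>x\<close> lies in the maximal ideal. With \<open>z = 1/(1 + x*y)\<close>,
  either \<open>x*z\<close> is in \<open>A\<close> and then so is \<open>z = 1 - x*z*y\<close>, or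
  \<open>1/(x*z) = 1/x + y\<close> is in \<open>A\<close>, which would put \<open>1/x\<close>
  there.\<close>

lemma unit_one_plus:
  assumes "x \<in> A" "inverse x \<notin> A" "y \<in> A"
  shows "1 + x * y \<noteq> 0" "inverse (1 + x * y) \<in> A"
proof -
  have x0: "x \<noteq> 0" using assms zero_closed by auto
  show nz: "1 + x * y \<noteq> 0"
  proof
    assume "1 + x * y = 0"
    then have "x * (- y) = 1" by (simp add: add_eq_0_iff2)
    then have "inverse x = - y" using inverse_unique by blast
    then show False using assms uminus_closed by metis
  qed
  show "inverse (1 + x * y) \<in> A"
  proof (rule ccontr)
    let ?z = "inverse (1 + x * y)"
    assume z: "?z \<notin> A"
    show False
    proof (cases "x * ?z \<in> A")
      case True
      have "?z = 1 - x * ?z * y" using nz by (simp add: field_simps)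
      then show False using True z assms(3) by (metis diff_closed mult_closed one_closed)
    next
      case False
      then have "inverse (x * ?z) \<in> A" using total by blast
      moreover have "inverse (x * ?z) = inverse x + y" using nz x0 by (simp add: field_simps)
      ultimately have "inverse x + y - y \<in> A" using assms(3) diff_closed by metis
      then show False using assms by simp
    qed
  qed
qed

text \<open>If \<open>x\<close> is not in \<open>A\<close> then \<open>1/x\<close> is, and dividing
  the monic equation of degree \<open>n\<close> by \<open>x^(n-1)\<close> expresses \<open>x\<close>
  as a polynomial in \<open>1/x\<close> over \<open>A\<close>.\<close>

lemma integrally_closed:
  assumes "lead_coeff p = 1" "\<forall>i. coeff p i \<in> A" "poly p x = 0"
  shows "x \<in> A"
proof (rule ccontr)
  assume x: "x \<notin> A"
  then have x0: "x \<noteq> 0" and ix: "inverse x \<in> A" using zero_closed total by auto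
  define n where "n = degree p"
  have "n > 0" using assms(1,3) unfolding n_def by (metis bot_nat_0.not_eq_extremum degree_eq_zeroE lead_coeff_pCons(2)
        mult_zero_right one_neq_zero poly_pCons poly_0 add_0_right)
  then obtain m where m: "n = Suc m" by (cases n) auto
  have "0 = (\<Sum>i\<le>n. coeff p i * x ^ i)" using assms(3) by (simp add: poly_altdef n_def)
  also have "\<dots> = (\<Sum>i\<le>m. coeff p i * x ^ i) + x ^ Suc m"
    using assms(1) by (simp add: m n_def[symmetric])
  finally have "x ^ Suc m = - (\<Sum>i\<le>m. coeff p i * x ^ i)" by (simp add: add_eq_0_iff)
  then have "x * x ^ m * inverse x ^ m = - (\<Sum>i\<le>m. coeff p i * x ^ i) * inverse x ^ m" by simp
  also have "x * x ^ m * inverse x ^ m = x" using x0 by (simp add: field_simps)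
  also have "- (\<Sum>i\<le>m. coeff p i * x ^ i) * inverse x ^ m
      = - (\<Sum>i\<le>m. coeff p i * inverse x ^ (m - i))"
  proof -
    have "x ^ i * inverse x ^ m = inverse x ^ (m - i)" if "i \<le> m" for i
      using that x0 by (simp add: power_diff field_simps)
    then show ?thesis by (simp add: sum_distrib_right mult.assoc)
  qed
  also have "\<dots> \<in> A" using assms(2) ix by (auto intro!: closed sum_closed)
  finally show False using x by simp
qed

end

text \<open>A relation of degree \<open>n\<close> for \<open>x\<close> is shortened by means of one of degree \<open>m \<le> n\<close> for \<open>1/x\<close>.\<close>

lemma adjoin_maximal_step:
  assumes "unital_subring B" "\<pi> \<in> B" "\<pi> \<noteq> 0" "u \<in> B" "u * (1 - \<pi> * r 0) = 1" "x \<noteq> 0" "m \<le> n"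
    and "\<forall>i. c i \<in> B" "\<pi> * (\<Sum>i\<le>n. c i * x ^ i) = 1"
    and "\<forall>i. r i \<in> B" "\<pi> * (\<Sum>i\<le>m. r i * inverse x ^ i) = 1"
    and "n > 0"
  shows "\<exists>c'. (\<forall>i. c' i \<in> B) \<and> \<pi> * (\<Sum>i\<le>n - 1. c' i * x ^ i) = 1"
proof -
  interpret unital_subring B by fact
  define s where "s = (\<lambda>i. if i \<le> m then r i else 0)"
  have s: "s i \<in> B" for i using assms(10) by (auto simp: s_def zero_closed)
  obtain k where k: "n = Suc k" using assms(12) by (cases n) auto
  have "(\<Sum>i\<le>m. r i * inverse x ^ i) = (\<Sum>i\<le>n. s i * inverse x ^ i)"
    using assms(7) by (intro sum.mono_neutral_cong_left) (auto simp: s_def)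
  then have "x ^ n = \<pi> * (x ^ n * (\<Sum>i\<le>n. s i * inverse x ^ i))"
    using assms(11) by (simp add: mult.left_commute)
  also have "x ^ n * (\<Sum>i\<le>n. s i * inverse x ^ i) = (\<Sum>i\<le>n. s i * x ^ (n - i))"
    using assms(6) by (simp add: sum_distrib_left power_diff field_simps)
  also have "\<dots> = (\<Sum>i\<le>n. s (n - i) * x ^ i)"
    by (rule sum.reindex_bij_witness[of _ "\<lambda>i. n - i" "\<lambda>i. n - i"]) auto
  also have "\<dots> = (\<Sum>i\<le>k. s (n - i) * x ^ i) + r 0 * x ^ n"
    by (simp add: k s_def)
  finally have "(1 - \<pi> * r 0) * x ^ n = \<pi> * (\<Sum>i\<le>k. s (n - i) * x ^ i)"
    by (simp add: algebra_simps)
  \<comment> \<open>Inverting the unit \<open>1 - \<pi> * r 0\<close> turns the top power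
    \<open>x^n\<close> into a combination of lower ones; \<open>c'\<close> arises by substituting
    this in the relation for \<open>x\<close>.\<close>
  then have xn: "x ^ n = u * \<pi> * (\<Sum>i\<le>k. s (n - i) * x ^ i)"
    using assms(5) by (metis mult.assoc mult.left_neutral)
  define c' where "c' = (\<lambda>i. c i + c n * u * \<pi> * s (n - i))"
  have "(\<Sum>i\<le>k. c' i * x ^ i) = (\<Sum>i\<le>k. c i * x ^ i) + c n * (u * \<pi> * (\<Sum>i\<le>k. s (n - i) * x ^ i))"
    by (simp add: c'_def sum.distrib sum_distrib_left algebra_simps)
  also have "\<dots> = (\<Sum>i\<le>n. c i * x ^ i)" unfolding xn[symmetric] by (simp add: k)
  finally have "\<pi> * (\<Sum>i\<le>n - 1. c' i * x ^ i) = 1" using assms(9) by (simp add: k)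
  moreover have "\<forall>i. c' i \<in> B" using assms s by (auto simp: c'_def intro!: closed)
  ultimately show ?thesis by blast
qed

text \<open>A subring that is maximal among those in which \<open>\<pi>\<close> is not invertible is a valuation ring.\<close>

theorem valuation_ring_exists:
  fixes A :: "'a :: field set"
  assumes A: "unital_subring A" and pi: "\<pi> \<in> A" "inverse \<pi> \<notin> A"
  shows "\<exists>V. valuation_ring V \<and> A \<subseteq> V \<and> inverse \<pi> \<notin> V"
proof -
  define S where "S = {B. unital_subring B \<and> A \<subseteq> B \<and> inverse \<pi> \<notin> B}"
  have "\<exists>M\<in>S. \<forall>X\<in>S. M \<subseteq> X \<longrightarrow> X = M"
  proof (rule subset_Zorn_nonempty)
    show "S \<noteq> {}" using assms by (auto simp: S_def)
  next
    fix C assume C: "C \<noteq> {}" "subset.chain S C"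
    then have sub: "B \<in> C \<Longrightarrow> unital_subring B \<and> A \<subseteq> B \<and> inverse \<pi> \<notin> B" for B
      unfolding subset.chain_def S_def by auto
    have two: "\<exists>B\<in>C. x \<in> B \<and> y \<in> B" if xy: "x \<in> \<Union>C" "y \<in> \<Union>C" for x y
    proof -
      obtain B B' where "B \<in> C" "x \<in> B" "B' \<in> C" "y \<in> B'" using xy by blast
      moreover have "B \<subseteq> B' \<or> B' \<subseteq> B"
        using C(2) \<open>B \<in> C\<close> \<open>B' \<in> C\<close> by (auto simp: subset_chain_def)
      ultimately show ?thesis by blast
    qed
    have "unital_subring (\<Union>C)"
    proof
      show "1 \<in> \<Union>C" using C(1) sub unital_subring.one_closed by blast
      show "x - y \<in> \<Union>C" if "x \<in> \<Union>C" "y \<in> \<Union>C" for x y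
        using two[OF that] sub unital_subring.diff_closed by blast
      show "x * y \<in> \<Union>C" if "x \<in> \<Union>C" "y \<in> \<Union>C" for x y
        using two[OF that] sub unital_subring.mult_closed by blast
    qed
    then show "\<Union>C \<in> S" using C(1) sub unfolding S_def by blast
  qed
  then obtain B where BS: "B \<in> S" and maxS: "\<forall>X\<in>S. B \<subseteq> X \<longrightarrow> X = B"
    by (elim bexE)
  then have B: "unital_subring B" "A \<subseteq> B" "inverse \<pi> \<notin> B" by (simp_all add: S_def)
  have max: "X = B" if "unital_subring X" "A \<subseteq> X" "inverse \<pi> \<notin> X" "B \<subseteq> X" for X
    using maxS that by (simp add: S_def)
  interpret unital_subring B by fact
  have piB: "\<pi> \<in> B" using pi B by auto
  have pi0: "\<pi> \<noteq> 0" using piB B(3) by auto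
  have adj: "x \<in> B" if "inverse \<pi> \<notin> adjoin B x" for x
    using max[OF unital_subring_adjoin _ that subset_adjoin] mem_adjoin B(2) subset_adjoin by blast
  have not1: "\<pi> * b \<noteq> 1" if "b \<in> B" for b
    using that B(3) by (metis inverse_unique)
  \<comment> \<open>With \<open>c = 1 - \<pi> * b\<close>: were \<open>1/\<pi>\<close> a polynomial
    of degree \<open>k\<close> in \<open>1/c\<close>, clearing denominators would put
    \<open>c^k\<close> in \<open>\<pi> B\<close>, although \<open>c^k\<close> is congruent to
    \<open>1\<close> modulo \<open>\<pi>\<close>. So maximality puts \<open>1/c\<close> in
    \<open>B\<close>.\<close>
  have unit: "\<exists>u\<in>B. u * (1 - \<pi> * b) = 1" if b: "b \<in> B" for b
  proof -
    define c where "c = 1 - \<pi> * b"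
    have c: "c \<in> B" "c \<noteq> 0" using b piB not1[OF b] by (auto simp: c_def intro: closed)
    have pow: "\<exists>d\<in>B. c ^ k = 1 - \<pi> * d" for k
    proof (induction k)
      case 0
      then show ?case using zero_closed by (auto intro!: bexI[of _ 0])
    next
      case (Suc k)
      then obtain d where d: "d \<in> B" "c ^ k = 1 - \<pi> * d" by auto
      have "c ^ Suc k = (1 - \<pi> * b) * (1 - \<pi> * d)" unfolding power_Suc d(2) by (simp add: c_def)
      also have "\<dots> = 1 - \<pi> * (b + d - \<pi> * b * d)" by (simp add: algebra_simps)
      finally show ?case using d b piB by (blast intro: closed)
    qed
    have "inverse \<pi> \<notin> adjoin B (inverse c)"
    proof
      assume "inverse \<pi> \<in> adjoin B (inverse c)"
      then obtain q where q: "\<forall>i. coeff q i \<in> B" "inverse \<pi> = poly q (inverse c)"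
        unfolding adjoin_def by auto
      define k where "k = degree q"
      define e where "e = (\<Sum>i\<le>k. coeff q i * c ^ (k - i))"
      have "e \<in> B" unfolding e_def using q c by (auto intro!: closed sum_closed)
      have "c ^ k * inverse \<pi> = e"
        unfolding q(2) e_def poly_altdef k_def using c
        by (simp add: sum_distrib_left power_diff field_simps)
      then have ck: "c ^ k = \<pi> * e" using pi0 by (simp add: field_simps)
      obtain d where d: "d \<in> B" "c ^ k = 1 - \<pi> * d" using pow by blast
      then have "\<pi> * (d + e) = 1" using ck by (simp add: algebra_simps)
      then show False using not1 d \<open>e \<in> B\<close> add_closed by blast
    qed
    then have "inverse c \<in> B" by (rule adj)
    then show ?thesis using c by (auto simp: c_def intro!: bexI[of _ "inverse c"])
  qed
  \<comment> \<open>Descent on the sum of the degrees: the longer relation is shortened by the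
    other, with \<open>x\<close> and \<open>1/x\<close> exchanged if necessary, and degree
    \<open>0\<close> contradicts \<open>not1\<close>.\<close>
  have no: False
    if "x \<noteq> 0" "\<forall>i. c i \<in> B" "\<pi> * (\<Sum>i\<le>n. c i * x ^ i) = 1"
      "\<forall>i. r i \<in> B" "\<pi> * (\<Sum>i\<le>m. r i * inverse x ^ i) = 1" for x c n r m
    using that
  proof (induction "n + m" arbitrary: n m c r rule: less_induct)
    case less
    have n: "n > 0"
    proof (rule ccontr)
      assume "\<not> n > 0"
      then show False using less.prems(2,3) not1[of "c 0"] by simp
    qed
    have m: "m > 0"
    proof (rule ccontr)
      assume "\<not> m > 0"
      then show False using less.prems(4,5) not1[of "r 0"] by simp
    qed
    show False
    proof (cases "m \<le> n")
      case True
      obtain u where u: "u \<in> B" "u * (1 - \<pi> * r 0) = 1" using unit less.prems(4) by blast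
      obtain c' where "\<forall>i. c' i \<in> B" "\<pi> * (\<Sum>i\<le>n - 1. c' i * x ^ i) = 1"
        using adjoin_maximal_step[of B \<pi> u r x m n c] u less.prems B(1) piB pi0 True n by blast
      then show False using less.hyps[of "n - 1" m c' r] less.prems n by simp
    next
      case False
      obtain u where u: "u \<in> B" "u * (1 - \<pi> * c 0) = 1" using unit less.prems(2) by blast
      obtain r' where "\<forall>i. r' i \<in> B" "\<pi> * (\<Sum>i\<le>m - 1. r' i * inverse x ^ i) = 1"
        using adjoin_maximal_step[of B \<pi> u c "inverse x" n m r] u less.prems B(1) piB pi0 False m
        by auto
      then show False using less.hyps[of n "m - 1" c r'] less.prems m by simp
    qed
  qed
  have "valuation_ring B"
  proof
    fix x show "x \<in> B \<or> inverse x \<in> B"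
    proof (rule ccontr)
      assume x: "\<not> (x \<in> B \<or> inverse x \<in> B)"
      then have "inverse \<pi> \<in> adjoin B x" "inverse \<pi> \<in> adjoin B (inverse x)" using adj by blast+
      then obtain p q where pq: "\<forall>i. coeff p i \<in> B" "inverse \<pi> = poly p x"
          "\<forall>i. coeff q i \<in> B" "inverse \<pi> = poly q (inverse x)"
        unfolding adjoin_def by auto
      have "x \<noteq> 0" using x zero_closed by auto
      moreover have "\<pi> * (\<Sum>i\<le>degree p. coeff p i * x ^ i) = 1"
        unfolding poly_altdef[symmetric] pq(2)[symmetric] using pi0 by simp
      moreover have "\<pi> * (\<Sum>i\<le>degree q. coeff q i * inverse x ^ i) = 1"
        unfolding poly_altdef[symmetric] pq(4)[symmetric] using pi0 by simp
      ultimately show False using no pq(1,3) by blast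
    qed
  qed
  then show ?thesis using B by blast
qed

section \<open>Places of the complex numbers\<close>

lemma unital_subring_Rats: "unital_subring (\<rat> :: 'a :: field_char_0 set)"
  by unfold_locales auto

lemma unital_subring_Ints: "unital_subring (\<int> :: 'a :: field_char_0 set)"
  by unfold_locales auto

lemma valuation_ring_over_2:
  "\<exists>V :: complex set. valuation_ring V \<and> inverse 2 \<notin> V"
proof -
  have "inverse 2 \<notin> (\<int> :: complex set)"
  proof
    assume "inverse 2 \<in> (\<int> :: complex set)"
    then obtain k where "inverse 2 = (of_int k :: complex)" by (elim Ints_cases)
    then have "(of_int (2 * k) :: complex) = of_int 1" by (simp add: mult.commute)
    then have "2 * k = 1" by (simp only: of_int_eq_iff)
    then show False by presburger
  qed
  then show ?thesis using valuation_ring_exists[OF unital_subring_Ints, of "2 :: complex"] by auto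
qed

text \<open>The place \<open>t = 0\<close>: if \<open>1/t = q(t)\<close> with rational coefficients,
  then \<open>t\<close> would be a root of the nonzero polynomial \<open>t q(t) - 1\<close>.\<close>

lemma valuation_ring_transcendental:
  fixes t :: complex
  assumes "\<not> algebraic t"
  shows "\<exists>V. valuation_ring V \<and> \<rat> \<subseteq> V \<and> t \<in> V \<and> inverse t \<notin> V"
proof -
  interpret unital_subring "\<rat> :: complex set" by (rule unital_subring_Rats)
  have t0: "t \<noteq> 0" using assms by auto
  have "inverse t \<notin> adjoin \<rat> t"
  proof
    assume "inverse t \<in> adjoin \<rat> t"
    then obtain q where q: "\<forall>i. coeff q i \<in> \<rat>" "inverse t = poly q t" unfolding adjoin_def by auto
    have "poly (pCons (- 1) q) t = 0" using t0 q(2)[symmetric] by simp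
    moreover have "\<forall>i. coeff (pCons (- 1) q) i \<in> \<rat>"
      using q by (auto simp: coeff_pCons split: nat.splits)
    moreover have "pCons (- 1) q \<noteq> 0" by simp
    ultimately show False using assms unfolding algebraic_altdef by blast
  qed
  from valuation_ring_exists[OF unital_subring_adjoin mem_adjoin this]
  show ?thesis using subset_adjoin mem_adjoin by blast
qed

lemma algebraic_mem_valuation_ring:
  fixes x :: complex
  assumes "valuation_ring V" "\<rat> \<subseteq> V" "algebraic x"
  shows "x \<in> V"
proof -
  interpret valuation_ring V by fact
  obtain p where p: "\<forall>i. coeff p i \<in> \<rat>" "p \<noteq> 0" "poly p x = 0"
    using assms(3) unfolding algebraic_altdef by auto
  let ?q = "smult (inverse (lead_coeff p)) p"
  have "\<forall>i. coeff ?q i \<in> V" using p(1) assms(2) by (auto intro!: Rats_mult)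
  moreover have "lead_coeff ?q = 1" using p(2) by simp
  ultimately show ?thesis using integrally_closed[of ?q x] p(3) by auto
qed

section \<open>Torsion points of \<open>E\<close> over a valuation ring of residue characteristic 2\<close>

definition on_E :: "complex \<Rightarrow> complex \<Rightarrow> bool" where
  "on_E x y \<longleftrightarrow> y\<^sup>2 = x ^ 3 + 2 * x\<^sup>2 - 1"

text \<open>The slope \<open>m\<close> of the chord or tangent; the last conjunct is the condition that the line
  through \<open>(x, y)\<close> with slope \<open>m\<close> meets \<open>E\<close> again at abscissa \<open>q\<close>.\<close>

lemma ec_add_slope:
  assumes "ec_add (Affine q r) (Affine x y) = Affine s t" "on_E q r" "on_E x y"
  obtains m where "s = m\<^sup>2 - 2 - q - x" "t = m * (x - s) - y" "r = y + m * (q - x)"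
    "2 * y * m = q\<^sup>2 + q * x + x\<^sup>2 + 2 * q + 2 * x - m\<^sup>2 * (q - x)"
proof (cases "q = x")
  case True
  then have "r \<noteq> - y" using assms(1) by auto
  moreover have "r\<^sup>2 = y\<^sup>2" using assms(2,3) True by (simp add: on_E_def)
  ultimately have ry: "r = y" by (auto simp: power2_eq_iff)
  then have y: "y \<noteq> 0" using \<open>r \<noteq> - y\<close> by auto
  define m where "m = (3 * q\<^sup>2 + 4 * q) / (2 * r)"
  have "s = m\<^sup>2 - 2 - q - x" "t = m * (q - s) - r"
    using assms(1) True ry y by (auto simp: m_def Let_def)
  moreover have "2 * y * m = 3 * q\<^sup>2 + 4 * q" using y ry by (simp add: m_def)
  ultimately show ?thesis using that[of m] True ry
    by (simp add: power2_eq_square algebra_simps)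
next
  case False
  define m where "m = (y - r) / (x - q)"
  have st: "s = m\<^sup>2 - 2 - q - x" "t = m * (q - s) - r"
    using assms(1) False by (auto simp: m_def Let_def)
  have "m * (x - q) = y - r" using False by (simp add: m_def)
  then have r: "r = y + m * (q - x)" by (simp add: algebra_simps)
  \<comment> \<open>The difference of the two curve equations is divisible by \<open>q - x\<close>;
    cancelling this factor leaves the condition that the tangent slope also satisfies.\<close>
  have "(q - x) * (2 * y * m - (q\<^sup>2 + q * x + x\<^sup>2 + 2 * q + 2 * x - m\<^sup>2 * (q - x)))
      = (y + m * (q - x))\<^sup>2 - y\<^sup>2 - (q ^ 3 + 2 * q\<^sup>2 - 1) + (x ^ 3 + 2 * x\<^sup>2 - 1)"
    by (simp add: power2_eq_square power3_eq_cube algebra_simps)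
  also have "\<dots> = 0" using assms(2,3) unfolding r on_E_def by simp
  finally have "2 * y * m = q\<^sup>2 + q * x + x\<^sup>2 + 2 * q + 2 * x - m\<^sup>2 * (q - x)"
    using False by simp
  then show ?thesis using that[of m] st r by (simp add: algebra_simps)
qed

lemma on_E_ec_add:
  assumes "ec_add (Affine q r) (Affine x y) = Affine s t" "on_E q r" "on_E x y"
  shows "on_E s t"
proof -
  obtain m where m: "s = m\<^sup>2 - 2 - q - x" "t = m * (x - s) - y"
      "2 * y * m = q\<^sup>2 + q * x + x\<^sup>2 + 2 * q + 2 * x - m\<^sup>2 * (q - x)"
    using ec_add_slope[OF assms] by blast
  have "y\<^sup>2 = x ^ 3 + 2 * x\<^sup>2 - 1" using assms by (simp add: on_E_def)
  then show ?thesis using m unfolding on_E_def by algebra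
qed

text \<open>The point preceding \<open>(s, t)\<close> lies on the line through \<open>-(s, t)\<close> and \<open>(x, y)\<close>, so both
  neighbours of \<open>(s, t)\<close> are explicit without appeal to associativity.\<close>

lemma ec_add_back:
  assumes "ec_add (Affine q r) (Affine x y) = Affine s t" "on_E q r" "on_E x y" "s \<noteq> x"
  shows "q = ((- t - y) / (s - x))\<^sup>2 - 2 - s - x"
    "r = - (((- t - y) / (s - x)) * (x - q) - y)"
proof -
  obtain m where m: "s = m\<^sup>2 - 2 - q - x" "t = m * (x - s) - y" "r = y + m * (q - x)"
    using ec_add_slope[OF assms(1-3)] by blast
  have "m * (s - x) = - t - y" using m(2) by (simp add: algebra_simps)
  then have eq: "(- t - y) / (s - x) = m" using assms(4) by (simp add: field_simps)
  show "q = ((- t - y) / (s - x))\<^sup>2 - 2 - s - x"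
    "r = - (((- t - y) / (s - x)) * (x - q) - y)"
    unfolding eq using m by (simp_all add: algebra_simps)
qed

text \<open>The chord is written from \<open>(x, y)\<close>, so that replacing \<open>t\<close> by
  \<open>-t\<close> gives the formulas of \<open>ec_add_back\<close> up to the sign of the ordinate;
  \<open>reflect\<close> compares the two.\<close>

lemma ec_add_chord:
  assumes "ec_add (Affine s t) (Affine x y) = Affine s' t'" "s \<noteq> x"
  shows "s' = ((t - y) / (s - x))\<^sup>2 - 2 - s - x"
    "t' = ((t - y) / (s - x)) * (x - s') - y"
proof -
  have eq: "(y - t) / (x - s) = (t - y) / (s - x)"
    by (metis minus_diff_eq minus_divide_divide)
  define m where "m = (t - y) / (s - x)"
  have s': "s' = m\<^sup>2 - 2 - s - x" "t' = m * (s - s') - t"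
    using assms eq by (auto simp: Let_def m_def)
  have "m * (s - x) = t - y" using assms by (simp add: m_def)
  then have "t' = m * (x - s') - y" using s'(2) by algebra
  then show "s' = ((t - y) / (s - x))\<^sup>2 - 2 - s - x"
    "t' = ((t - y) / (s - x)) * (x - s') - y"
    using s'(1) by (simp_all add: m_def)
qed

text \<open>With \<open>Q = (s, t)\<close> and \<open>P = (x, y)\<close>, the slopes for
  \<open>Q - P\<close> and \<open>Q + P\<close> differ only in the sign of \<open>t\<close>. So sum
  and product of the two abscissae involve \<open>t\<close> only through \<open>t^2\<close>, which
  the curve equation eliminates.\<close>

lemma ec_neighbours:
  assumes "ec_add (Affine q r) (Affine x y) = Affine s t"
    "ec_add (Affine s t) (Affine x y) = Affine s' t'"
    "on_E q r" "on_E x y" "s \<noteq> x"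
  shows "(q + s') * (s - x)\<^sup>2 = 2 * (s\<^sup>2 * x + s * x\<^sup>2 + 4 * s * x - 2)"
    "q * s' * (s - x)\<^sup>2 = x\<^sup>2 * s\<^sup>2 + 4 * (s + x + 2)"
proof -
  have c: "y\<^sup>2 = x ^ 3 + 2 * x\<^sup>2 - 1" "t\<^sup>2 = s ^ 3 + 2 * s\<^sup>2 - 1"
    using assms on_E_ec_add on_E_def by blast+
  define a b where "a = (- t - y) / (s - x)" and "b = (t - y) / (s - x)"
  have ab: "a * (s - x) = - t - y" "b * (s - x) = t - y"
    using assms(5) by (simp_all add: a_def b_def)
  have q: "q = a\<^sup>2 - 2 - s - x" using ec_add_back(1)[OF assms(1,3,4,5)] by (simp add: a_def)
  have s': "s' = b\<^sup>2 - 2 - s - x" using ec_add_chord(1)[OF assms(2,5)] by (simp add: b_def)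
  have "(q + s') * (s - x)\<^sup>2 = (a * (s - x))\<^sup>2 + (b * (s - x))\<^sup>2 - 2 * (2 + s + x) * (s - x)\<^sup>2"
    unfolding q s' by (simp add: power2_eq_square algebra_simps)
  also have "\<dots> = 2 * (t\<^sup>2 + y\<^sup>2) - 2 * (2 + s + x) * (s - x)\<^sup>2"
    unfolding ab by (simp add: power2_eq_square algebra_simps)
  also have "\<dots> = 2 * (s\<^sup>2 * x + s * x\<^sup>2 + 4 * s * x - 2)"
    unfolding c by (simp add: power2_eq_square power3_eq_cube algebra_simps)
  finally show "(q + s') * (s - x)\<^sup>2 = 2 * (s\<^sup>2 * x + s * x\<^sup>2 + 4 * s * x - 2)" .
  \<comment> \<open>A second factor \<open>(s - x)^2\<close> clears both squared slopes; it cancels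
    once the curve equations have been used.\<close>
  have "(q * s' * (s - x)\<^sup>2) * (s - x)\<^sup>2
      = ((a * (s - x))\<^sup>2 - (2 + s + x) * (s - x)\<^sup>2) * ((b * (s - x))\<^sup>2 - (2 + s + x) * (s - x)\<^sup>2)"
    unfolding q s' by (simp add: power2_eq_square algebra_simps)
  also have "\<dots> = (t\<^sup>2 - y\<^sup>2)\<^sup>2 - 2 * (2 + s + x) * (s - x)\<^sup>2 * (t\<^sup>2 + y\<^sup>2) + (2 + s + x)\<^sup>2 * (s - x) ^ 4"
    unfolding ab by algebra
  also have "\<dots> = (x\<^sup>2 * s\<^sup>2 + 4 * (s + x + 2)) * (s - x)\<^sup>2"
    unfolding c by algebra
  finally show "q * s' * (s - x)\<^sup>2 = x\<^sup>2 * s\<^sup>2 + 4 * (s + x + 2)"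
    using assms(5) by simp
qed

text \<open>\<open>Q + P = -P\<close> means that the line through \<open>Q\<close> and
  \<open>P\<close> meets the curve at \<open>P\<close> once more, so it is the tangent at
  \<open>P\<close> and \<open>Q = -2P\<close>.\<close>

lemma ec_add_eq_uminus:
  assumes "ec_add (Affine q r) (Affine x y) = Affine x (- y)"
    "ec_add (Affine x y) (Affine x y) = Affine s t" "on_E q r" "on_E x y" "y \<noteq> 0"
  shows "q = s" "r = - t"
proof -
  obtain m where m: "x = m\<^sup>2 - 2 - q - x" "r = y + m * (q - x)"
      "2 * y * m = q\<^sup>2 + q * x + x\<^sup>2 + 2 * q + 2 * x - m\<^sup>2 * (q - x)"
    using ec_add_slope[OF assms(1,3,4)] by blast
  obtain m' where m': "s = m'\<^sup>2 - 2 - x - x" "t = m' * (x - s) - y"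
      "2 * y * m' = x\<^sup>2 + x * x + x\<^sup>2 + 2 * x + 2 * x - m'\<^sup>2 * (x - x)"
    using ec_add_slope[OF assms(2,4,4)] by blast
  have mm: "m\<^sup>2 = q + 2 * x + 2" using m(1) by (simp add: algebra_simps)
  have "2 * y * m = 2 * y * m'"
    unfolding m(3) m'(3) mm by (simp add: power2_eq_square algebra_simps)
  then have eq: "m = m'" using assms(5) by simp
  show qs: "q = s" using mm m'(1) eq by simp
  show "r = - t" unfolding m(2) m'(2) eq qs by (simp add: algebra_simps)
qed

section \<open>Multiples of a torsion point\<close>

definition ec_mult :: "nat \<Rightarrow> ec_point \<Rightarrow> ec_point" where
  "ec_mult n P = ((\<lambda>Q. ec_add Q P) ^^ n) Infinity"

lemma ec_mult_simps [simp]: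
  "ec_mult 0 P = Infinity" "ec_mult (Suc n) P = ec_add (ec_mult n P) P"
  by (simp_all add: ec_mult_def)

lemma pow_ec_group: "P [^]\<^bsub>ec_group K\<^esub> n = ec_mult n P"
  by (induction n) (simp_all add: nat_pow_def ec_group_def)

locale torsion_point =
  fixes x y :: complex and n :: nat
  assumes on_E: "on_E x y" and y0: "y \<noteq> 0"
    and n0: "n > 0" and n_torsion: "ec_mult n (Affine x y) = Infinity"
    and minimal: "0 < k \<Longrightarrow> k < n \<Longrightarrow> ec_mult k (Affine x y) \<noteq> Infinity"
begin

text \<open>Coordinates of \<open>k P\<close>, guaranteed to be meaningful for
  \<open>0 < k < n\<close>, where minimality of \<open>n\<close> keeps the multiple away from
  \<open>Infinity\<close>.\<close>

definition X where "X k = (THE s. \<exists>t. ec_mult k (Affine x y) = Affine s t)"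
definition Y where "Y k = (THE t. \<exists>s. ec_mult k (Affine x y) = Affine s t)"

lemma mult_eq: "0 < k \<Longrightarrow> k < n \<Longrightarrow> ec_mult k (Affine x y) = Affine (X k) (Y k)"
  using minimal[of k] by (cases "ec_mult k (Affine x y)") (auto simp: X_def Y_def)

lemma n_ge: "n \<ge> 3"
proof -
  have "n \<noteq> 1" using n_torsion by auto
  moreover have "n \<noteq> 2"
  proof
    assume "n = 2"
    then have "ec_add (Affine x y) (Affine x y) = Infinity"
      using n_torsion by (simp add: numeral_2_eq_2)
    then have "y = - y" by (auto simp: Let_def split: if_splits)
    then show False using y0 by simp
  qed
  ultimately show ?thesis using n0 by linarith
qed

lemma XY_1: "X 1 = x" "Y 1 = y"
  using mult_eq[of 1] n_ge by auto

lemma step: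
  assumes "0 < k" "Suc k < n"
  shows "ec_add (Affine (X k) (Y k)) (Affine x y) = Affine (X (Suc k)) (Y (Suc k))"
  using mult_eq[of k] mult_eq[of "Suc k"] assms by simp

lemma on_E_XY: "0 < k \<Longrightarrow> k < n \<Longrightarrow> on_E (X k) (Y k)"
proof (induction k)
  case (Suc k)
  show ?case
  proof (cases "k = 0")
    case True
    then show ?thesis using XY_1 on_E by simp
  next
    case False
    then show ?thesis using on_E_ec_add[OF step[of k]] Suc on_E by simp
  qed
qed simp

text \<open>\<open>k P = -P\<close> would make \<open>k + 1\<close> a smaller period. If
  \<open>k P = P\<close>, the ordinate formula of \<open>ec_add_slope\<close> at
  \<open>s = x\<close> gives \<open>y = -y\<close>. This licenses division by
  \<open>X k - x\<close>.\<close>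

lemma X_neq:
  assumes "1 < k" "Suc k < n"
  shows "X k \<noteq> x"
proof
  assume eq: "X k = x"
  have "Y k \<noteq> - y"
  proof
    assume "Y k = - y"
    then have "ec_mult (Suc k) (Affine x y) = Infinity"
      using eq mult_eq[of k] assms by simp
    then show False using minimal[of "Suc k"] assms by simp
  qed
  moreover have "(Y k)\<^sup>2 = y\<^sup>2"
    using on_E_XY[of k] on_E assms eq by (simp add: on_E_def)
  ultimately have "Y k = y" by (auto simp: power2_eq_iff)
  moreover have "\<exists>m. Y k = m * (x - X k) - y"
  proof -
    have "ec_add (Affine (X (k - 1)) (Y (k - 1))) (Affine x y) = Affine (X k) (Y k)"
      using step[of "k - 1"] assms by simp
    moreover have "on_E (X (k - 1)) (Y (k - 1))" using on_E_XY[of "k - 1"] assms by simp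
    ultimately show ?thesis using ec_add_slope on_E by metis
  qed
  ultimately have "y = - y" using eq by simp
  then show False using y0 by simp
qed

lemma XY_last: "X (n - 1) = x" "Y (n - 1) = - y"
proof -
  have "Suc (n - 1) = n" using n0 by simp
  then have "ec_add (Affine (X (n - 1)) (Y (n - 1))) (Affine x y) = Infinity"
    using n_torsion mult_eq[of "n - 1"] n_ge ec_mult_simps(2)[of "n - 1" "Affine x y"] by simp
  then show "X (n - 1) = x" "Y (n - 1) = - y" by (auto simp: Let_def split: if_splits)
qed

lemma neighbours:
  assumes "1 < k" "Suc k < n"
  shows "(X (k - 1) + X (Suc k)) * (X k - x)\<^sup>2
      = 2 * ((X k)\<^sup>2 * x + X k * x\<^sup>2 + 4 * X k * x - 2)"
    "X (k - 1) * X (Suc k) * (X k - x)\<^sup>2 = x\<^sup>2 * (X k)\<^sup>2 + 4 * (X k + x + 2)"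
proof -
  have s: "ec_add (Affine (X (k - 1)) (Y (k - 1))) (Affine x y) = Affine (X k) (Y k)"
    using step[of "k - 1"] assms by simp
  note ec_neighbours[OF s step[of k] on_E_XY[of "k - 1"] on_E X_neq[OF assms]]
  then show "(X (k - 1) + X (Suc k)) * (X k - x)\<^sup>2
      = 2 * ((X k)\<^sup>2 * x + X k * x\<^sup>2 + 4 * X k * x - 2)"
    "X (k - 1) * X (Suc k) * (X k - x)\<^sup>2 = x\<^sup>2 * (X k)\<^sup>2 + 4 * (X k + x + 2)"
    using assms by auto
qed

lemma double: "ec_add (Affine x y) (Affine x y) = Affine (X 2) (Y 2)"
proof -
  have "ec_mult 1 (Affine x y) = Affine x y"
    using mult_eq[of 1] n_ge XY_1 by (simp only:)
  moreover have "ec_mult 2 (Affine x y) = Affine (X 2) (Y 2)"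
    using mult_eq[of 2] n_ge by linarith
  moreover have "ec_mult 2 (Affine x y) = ec_add (ec_mult 1 (Affine x y)) (Affine x y)"
    by (metis ec_mult_simps(2) Suc_1)
  ultimately show ?thesis by metis
qed

lemma X_2: "X 2 * (4 * y\<^sup>2) = x ^ 4 + 8 * x + 8"
proof -
  obtain m where m: "X 2 = m\<^sup>2 - 2 - x - x"
      "2 * y * m = x\<^sup>2 + x * x + x\<^sup>2 + 2 * x + 2 * x - m\<^sup>2 * (x - x)"
    using ec_add_slope[OF double on_E on_E] by blast
  have "X 2 * (4 * y\<^sup>2) = (2 * y * m)\<^sup>2 - (2 + 2 * x) * (4 * y\<^sup>2)"
    unfolding m(1) by (simp add: power2_eq_square algebra_simps)
  also have "\<dots> = (3 * x\<^sup>2 + 4 * x)\<^sup>2 - (2 + 2 * x) * (4 * (x ^ 3 + 2 * x\<^sup>2 - 1))"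
    unfolding m(2) on_E[unfolded on_E_def] by (simp add: power2_eq_square add.commute)
  also have "\<dots> = x ^ 4 + 8 * x + 8" by algebra
  finally show ?thesis .
qed

text \<open>Induction from \<open>(n - 1) P = -P\<close>: one step back from \<open>-(k P)\<close>
  and one step forward from \<open>k P\<close> give opposite points, by \<open>ec_add_back\<close>
  and \<open>ec_add_chord\<close>. At \<open>k = 1\<close> the chord degenerates to the
  tangent.\<close>

lemma reflect:
  assumes "2 * k \<le> n" "0 < k"
  shows "X (n - k) = X k" "Y (n - k) = - Y k"
proof -
  have "X (n - k) = X k \<and> Y (n - k) = - Y k"
    using assms
  proof (induction k)
    case (Suc k)
    have nk: "Suc (n - Suc k) = n - k" "0 < n - Suc k" "n - k < n \<or> k = 0" using Suc.prems by auto
    consider "k = 0" | "k = 1" | "1 < k" by linarith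
    then show ?case
    proof cases
      case 1
      then show ?thesis using XY_last XY_1 by simp
    next
      case 2
      then have "ec_add (Affine (X (n - 2)) (Y (n - 2))) (Affine x y) = Affine x (- y)"
        using step[of "n - 2"] XY_last nk Suc.prems by (simp add: numeral_2_eq_2 eval_nat_numeral)
      moreover have "on_E (X (n - 2)) (Y (n - 2))" using on_E_XY[of "n - 2"] 2 Suc.prems by simp
      ultimately show ?thesis
        using ec_add_eq_uminus[OF _ double] on_E y0 2 by (simp only: Suc_1) blast
    next
      case 3
      then have neq: "X k \<noteq> x" using X_neq[of k] Suc.prems by simp
      have IH: "X (n - k) = X k" "Y (n - k) = - Y k" using Suc 3 by auto
      have "ec_add (Affine (X (n - Suc k)) (Y (n - Suc k))) (Affine x y) = Affine (X k) (- Y k)"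
        using step[of "n - Suc k"] nk IH 3 by simp
      note b = ec_add_back[OF this on_E_XY on_E neq]
      note c = ec_add_chord[OF step[of k] neq]
      show ?thesis using b c nk(2) 3 Suc.prems by simp
    qed
  qed simp
  then show "X (n - k) = X k" "Y (n - k) = - Y k" by auto
qed

end

text \<open>With \<open>e\<^sub>k = 1/x(kP)\<close> the addition law becomes
  \<open>e\<^sub>k\<^sub>+\<^sub>1 + e\<^sub>k\<^sub>-\<^sub>1 = 2 (e\<^sub>k + e + 4 e e\<^sub>k - 2 e\<^sup>2 e\<^sub>k\<^sup>2) / (1 + 4 e e\<^sub>k (e + e\<^sub>k + 2 e e\<^sub>k))\<close>,
  so modulo \<open>w = 1/x(2P)\<close> the sequence alternates between \<open>e\<close> and \<open>0\<close>.\<close>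

theorem (in torsion_point) inverse_X_notin_valuation_ring:
  assumes V: "valuation_ring V" and two: "inverse 2 \<notin> V" and x0: "x \<noteq> 0"
  shows "inverse x \<notin> V"
proof
  interpret valuation_ring V by fact
  assume eV: "inverse x \<in> V"
  define e where "e = inverse x"
  have e: "e \<in> V" "e \<noteq> 0" "x = inverse e" using eV x0 by (auto simp: e_def)
  have V2: "2 \<in> V" by (rule numeral_closed)
  \<comment> \<open>\<open>g\<close> is \<open>y^2 e^3\<close> written in \<open>e = 1/x\<close>,
    and \<open>d\<close> inverts \<open>e^4 (x^4 + 8 x + 8)\<close>, which is \<open>1\<close>
    modulo \<open>2\<close>. By the duplication formula \<open>1/x(2P) = 4 e g d\<close>, the value
    called \<open>w\<close> below.\<close>
  define g where "g = 1 + 2 * e - e ^ 3"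
  define d where "d = inverse (1 + 2 * (4 * e ^ 3 + 4 * e ^ 4))"
  have arg: "4 * e ^ 3 + 4 * e ^ 4 \<in> V" using e by (auto intro!: closed)
  have d: "d \<in> V" "d \<noteq> 0" and "d * (1 + 2 * (4 * e ^ 3 + 4 * e ^ 4)) = 1"
    using unit_one_plus[OF V2 two arg] by (auto simp: d_def)
  then have d1: "d * (1 + 8 * e ^ 3 + 8 * e ^ 4) = 1" by (simp add: algebra_simps)
  have ex: "e * x = 1" and "y\<^sup>2 = x ^ 3 + 2 * x\<^sup>2 - 1" using e on_E by (auto simp: on_E_def)
  with ex have "y\<^sup>2 * e ^ 3 = g" unfolding g_def by algebra
  then have g: "g \<in> V" "y\<^sup>2 * e ^ 3 = g" using e by (auto simp: g_def intro!: closed)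
  have g0: "g \<noteq> 0" using g y0 e by auto
  define w where "w = 4 * e * g * d"
  have w: "w \<in> V" "w \<noteq> 0" using e g g0 d by (auto simp: w_def intro!: closed)
  \<comment> \<open>Every contradiction below makes \<open>4\<close> invertible in \<open>V\<close>;
    then \<open>1/2 = 2 t\<close> would lie in \<open>V\<close>.\<close>
  have not_4: "4 * t \<noteq> 1" if "t \<in> V" for t
  proof
    assume "4 * t = 1"
    then have "inverse 2 = 2 * t" by (simp add: field_simps)
    then show False using two mult_closed[OF V2 that] by metis
  qed
  have E2: "X 2 \<noteq> 0" "inverse (X 2) = w"
  proof -
    have "X 2 * (4 * (y\<^sup>2 * e ^ 3)) * e = (x ^ 4 + 8 * x + 8) * e ^ 4"
      unfolding X_2[symmetric] by (simp add: power3_eq_cube power4_eq_xxxx)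
    also have "\<dots> = 1 + 8 * e ^ 3 + 8 * e ^ 4"
      using ex by algebra
    finally have "d * (X 2 * (4 * g) * e) = 1" using d1 g(2) by simp
    then have "w * X 2 = 1" by (simp add: w_def ac_simps)
    then show "X 2 \<noteq> 0" "inverse (X 2) = w"
      using inverse_unique[of "X 2" w] by (auto simp: mult.commute)
  qed
  define a where "a k = (if odd k then e else 0)" for k :: nat
  \<comment> \<open>Nonvanishing is recorded separately because
    \<open>inverse 0 = 0\<close>.\<close>
  define good where "good k \<longleftrightarrow> X k \<noteq> 0 \<and> (\<exists>t\<in>V. inverse (X k) = a k + w * t)" for k
  have good_step: "good (Suc k)" if k: "1 < k" "Suc k < n" and gk: "good k" "good (k - 1)" for k
  proof -
    obtain t where t: "t \<in> V" "inverse (X k) = a k + w * t" using gk by (auto simp: good_def)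
    obtain t' where t': "t' \<in> V" "inverse (X (k - 1)) = a (k - 1) + w * t'"
      using gk by (auto simp: good_def)
    define E where "E = inverse (X k)"
    have aV: "a k \<in> V" using e by (auto simp: a_def closed)
    have p0: "X (k - 1) \<noteq> 0" "X k \<noteq> 0" using gk by (simp_all add: good_def)
    have "E * X k = 1" using p0 by (simp add: E_def)
    moreover have "E \<in> V"
      unfolding E_def t(2) by (intro add_closed mult_closed aV w t(1))
    ultimately have E: "E \<in> V" "E * X k = 1" by auto
    \<comment> \<open>\<open>D\<close> and \<open>N\<close> are the right-hand sides for the product
      and the sum in \<open>neighbours\<close>, divided by \<open>x^2 (X k)^2\<close>. As
      \<open>D\<close> is a unit, \<open>X (Suc k)\<close> cannot vanish.\<close>
    define D where "D = 1 + 2 * (2 * e * E * (e + E + 2 * e * E))"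
    have arg: "2 * e * E * (e + E + 2 * e * E) \<in> V" using e E by (auto intro!: closed)
    have D: "D \<noteq> 0" "inverse D \<in> V"
      using unit_one_plus[OF V2 two arg] by (auto simp: D_def)
    define N where "N = 2 * (E + e + 4 * e * E - 2 * e\<^sup>2 * E\<^sup>2)"
    have xE: "x\<^sup>2 * (X k)\<^sup>2 * D = x\<^sup>2 * (X k)\<^sup>2 + 4 * (X k + x + 2)"
      using ex E(2) unfolding D_def by algebra
    have xN: "x\<^sup>2 * (X k)\<^sup>2 * N = 2 * ((X k)\<^sup>2 * x + X k * x\<^sup>2 + 4 * X k * x - 2)"
      using ex E(2) unfolding N_def by algebra
    have nz: "x\<^sup>2 * (X k)\<^sup>2 * D \<noteq> 0" using x0 p0 D by simp
    then have prod: "X (k - 1) * X (Suc k) * (X k - x)\<^sup>2 \<noteq> 0"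
      unfolding neighbours(2)[OF k] xE .
    then have Xs: "X (Suc k) \<noteq> 0" by auto
    have "(inverse (X (k - 1)) + inverse (X (Suc k))) * (X (k - 1) * X (Suc k) * (X k - x)\<^sup>2)
        = (X (k - 1) + X (Suc k)) * (X k - x)\<^sup>2"
      using p0(1) Xs by (simp add: field_simps)
    then have "(inverse (X (k - 1)) + inverse (X (Suc k))) * (x\<^sup>2 * (X k)\<^sup>2 * D) = x\<^sup>2 * (X k)\<^sup>2 * N"
      unfolding neighbours[OF k] xE xN by simp
    then have "(inverse (X (k - 1)) + inverse (X (Suc k))) * D = N"
      using x0 p0(2) by simp
    then have sum: "inverse (X (Suc k)) = N * inverse D - inverse (X (k - 1))"
      using D by (simp add: field_simps)
    \<comment> \<open>As a polynomial in \<open>E\<close>, \<open>N\<close> takes the value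
      \<open>4 e g\<close> at \<open>E = e\<close>, a multiple of \<open>w\<close>, and it is
      congruent to \<open>2 e D\<close> modulo \<open>E\<close>. These cases serve odd and even
      \<open>k\<close>.\<close>
    have "\<exists>s\<in>V. N * inverse D = a (k - 1) + a (Suc k) + w * s"
    proof (cases "odd k")
      case True
      then have Ee: "E = e + w * t" using t by (simp add: E_def a_def)
      define h where "h = 2 * (1 + 4 * e - 2 * e\<^sup>2 * (E + e))"
      have "h \<in> V" using e E by (auto simp: h_def intro!: closed)
      have "N = 4 * e * g + (E - e) * h"
        unfolding N_def g_def h_def by (simp add: power2_eq_square power3_eq_cube algebra_simps)
      also have "4 * e * g = w * (1 + 8 * e ^ 3 + 8 * e ^ 4)"
        using d1 by (simp add: w_def mult.assoc)
      finally have "N = w * (1 + 8 * e ^ 3 + 8 * e ^ 4 + t * h)"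
        using Ee by (simp add: algebra_simps)
      moreover have "(1 + 8 * e ^ 3 + 8 * e ^ 4 + t * h) * inverse D \<in> V"
        using e t D \<open>h \<in> V\<close> by (auto intro!: closed)
      ultimately show ?thesis using True by (auto simp: a_def mult.assoc)
    next
      case False
      then have Ew: "E = w * t" using t by (simp add: E_def a_def)
      define h where "h = 2 * (1 + 4 * e - 2 * e\<^sup>2 * E) - 8 * e\<^sup>2 * (e + E + 2 * e * E)"
      have "h \<in> V" using e E by (auto simp: h_def intro!: closed)
      have "N = 2 * e * D + E * h"
        unfolding N_def D_def h_def by (simp add: power2_eq_square algebra_simps)
      then have "N * inverse D = 2 * e + w * (t * h * inverse D)"
        using D Ew by (simp add: field_simps)
      moreover have "t * h * inverse D \<in> V" using t D \<open>h \<in> V\<close> by (auto intro!: closed)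
      ultimately show ?thesis using False k by (auto simp: a_def intro!: bexI)
    qed
    then obtain s where s: "s \<in> V" "N * inverse D = a (k - 1) + a (Suc k) + w * s" by auto
    have "inverse (X (Suc k)) = a (Suc k) + w * (s - t')"
      unfolding sum s t' by (simp add: algebra_simps)
    then show ?thesis using Xs s t' unfolding good_def by (blast intro: closed)
  qed
  have good: "good k" if "0 < k" "k < n" for k
    using that
  proof (induction k rule: less_induct)
    case (less k)
    consider "k = 1" | "k = 2" | "2 < k" using less.prems by linarith
    then show ?case
    proof cases
      case 1
      have "inverse (X 1) = a 1 + w * 0" unfolding XY_1(1) by (simp add: a_def e_def)
      then show ?thesis unfolding 1 good_def using zero_closed XY_1(1) x0 by metis
    next
      case 2
      have "inverse (X 2) = a 2 + w * 1" unfolding E2(2) by (simp add: a_def)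
      then show ?thesis unfolding 2 good_def using one_closed E2(1) by metis
    next
      case 3
      then obtain j where j: "k = Suc j" "1 < j" by (cases k) auto
      have "good j" "good (j - 1)" using less j by simp_all
      then show ?thesis using good_step[of j] j less.prems by simp
    qed
  qed
  \<comment> \<open>For odd \<open>n\<close> the point \<open>(n - 1) P = -P\<close> is an even
    multiple, so \<open>e\<close> would be divisible by \<open>w = 4 e g d\<close>.\<close>
  have "even n"
  proof (rule ccontr)
    assume "odd n"
    then have "even (n - 1)" by simp
    then obtain t where "t \<in> V" "inverse (X (n - 1)) = w * t"
      using good[of "n - 1"] n_ge by (auto simp: good_def a_def)
    then have "t \<in> V" "e = w * t" unfolding XY_last e_def by auto
    then have "4 * (g * d * t) = 1" using e(2) by (simp add: w_def mult.assoc)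
    moreover have "g * d * t \<in> V" by (intro mult_closed g d \<open>t \<in> V\<close>)
    ultimately show False using not_4 by blast
  qed
  then obtain m where m: "n = 2 * m" by auto
  have m0: "0 < m" "m < n" using m n_ge by auto
  \<comment> \<open>Halfway along, \<open>m P\<close> is its own negative, so \<open>1/X m\<close>
    is a root of the reversed cubic \<open>1 + 2 u - u^3\<close>.\<close>
  have "Y m = - Y m" using reflect(2)[of m] m m0 by simp
  then have "Y m = 0" by simp
  then have "X m ^ 3 + 2 * (X m)\<^sup>2 - 1 = 0" using on_E_XY[OF m0] by (simp add: on_E_def)
  moreover obtain t where t: "t \<in> V" "inverse (X m) = a m + w * t" and Xm: "X m \<noteq> 0"
    using good[OF m0] by (auto simp: good_def)
  moreover from Xm have "inverse (X m) * X m = 1" by simp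
  ultimately have u: "1 + 2 * (a m + w * t) = (a m + w * t) ^ 3"
    unfolding t(2)[symmetric] by algebra
  show False
  proof (cases "odd m")
    case True
    define u where "u = e + w * t"
    have "u \<in> V" using e w t by (auto simp: u_def intro!: closed)
    define c where "c = 2 - (e\<^sup>2 + e * u + u\<^sup>2)"
    have "c \<in> V" using e \<open>u \<in> V\<close> by (auto simp: c_def intro!: closed)
    have "1 + 2 * u = u ^ 3" using u True by (simp add: u_def a_def)
    \<comment> \<open>\<open>g\<close> is the reversed cubic at \<open>e\<close> and
      \<open>u\<close> is a root of it, so \<open>e - u\<close> divides \<open>g\<close>; but
      \<open>e - u = -w t\<close> is in turn divisible by \<open>4 g\<close>.\<close>
    then have gu: "g = (e - u) * c"
      unfolding g_def c_def by (simp add: power2_eq_square power3_eq_cube algebra_simps)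
    have "e - u = - (w * t)" by (simp add: u_def)
    then have "(e - u) * (4 * (- (e * c * d * t))) = e - u"
      using gu unfolding w_def by algebra
    moreover have "e - u \<noteq> 0" using gu g0 by auto
    ultimately have "4 * (- (e * c * d * t)) = 1" by (metis mult_cancel_left mult.right_neutral)
    moreover have "- (e * c * d * t) \<in> V" by (intro uminus_closed mult_closed e d t(1) \<open>c \<in> V\<close>)
    ultimately show False using not_4 by blast
  next
    case False
    then have "1 = (w * t) ^ 3 - 2 * (w * t)" using u by (simp add: a_def eq_diff_eq)
    also have "\<dots> = 4 * (e * g * d * t * ((w * t)\<^sup>2 - 2))"
      unfolding w_def by algebra
    finally have "4 * (e * g * d * t * ((w * t)\<^sup>2 - 2)) = 1" by metis
    moreover have "e * g * d * t * ((w * t)\<^sup>2 - 2) \<in> V"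
      by (intro mult_closed diff_closed power_closed numeral_closed e g d t(1) w)
    ultimately show False using not_4 by blast
  qed
qed

corollary torsion_inverse_x_notin_valuation_ring:
  assumes "on_E x y" "y \<noteq> 0" "x \<noteq> 0" "n > 0" "ec_mult n (Affine x y) = Infinity"
    and "valuation_ring V" "inverse 2 \<notin> V"
  shows "inverse x \<notin> V"
proof -
  define k where "k = (LEAST k. k > 0 \<and> ec_mult k (Affine x y) = Infinity)"
  have k: "k > 0 \<and> ec_mult k (Affine x y) = Infinity"
    unfolding k_def by (rule LeastI[of _ n]) (use assms in auto)
  interpret torsion_point x y k
  proof
    fix j assume "0 < j" "j < k"
    then show "ec_mult j (Affine x y) \<noteq> Infinity" using not_less_Least[of j] unfolding k_def by blast
  qed (use assms k in auto)
  show ?thesis using inverse_X_notin_valuation_ring assms by blast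
qed

section \<open>Groups\<close>

lemma word_class_eq_iff: "word_class u = word_class v \<longleftrightarrow> knot_eq u v"
  unfolding word_class_def by (blast intro: knot_eq.refl knot_eq.sym knot_eq.trans)

lemma mult_word_class: "word_class u \<otimes>\<^bsub>knot_group\<^esub> word_class v = word_class (u @ v)"
proof -
  have "knot_eq (u @ v) x" if "knot_eq u u'" "knot_eq v v'" "knot_eq (u' @ v') x" for u' v' x
    using that knot_eq.append knot_eq.trans by blast
  then show ?thesis
    by (auto simp: knot_group_def word_class_def intro: knot_eq.refl)
qed

lemma carrier_knot_group: "carrier knot_group = range word_class"
  and one_knot_group: "\<one>\<^bsub>knot_group\<^esub> = word_class []"
  by (simp_all add: knot_group_def)

definition inv_word :: "word \<Rightarrow> word" where
  "inv_word u = rev (map (\<lambda>(g, e). (g, \<not> e)) u)"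

lemma knot_eq_inv_word: "knot_eq (inv_word u @ u) []"
proof (induction u)
  case Nil
  then show ?case by (simp add: inv_word_def knot_eq.refl)
next
  case (Cons l u)
  obtain g e where l: "l = (g, e)" by fastforce
  have "knot_eq [(g, \<not> e), (g, e)] []" using knot_eq.cancel[of g "\<not> e"] by simp
  then have "knot_eq ([(g, \<not> e), (g, e)] @ u) ([] @ u)" by (rule knot_eq.append[OF _ knot_eq.refl])
  then have "knot_eq (inv_word u @ ([(g, \<not> e), (g, e)] @ u)) (inv_word u @ u)"
    using knot_eq.append[OF knot_eq.refl] by fastforce
  from knot_eq.trans[OF this Cons.IH] show ?case by (simp add: inv_word_def l)
qed

lemma group_knot_group: "group knot_group"
proof (rule groupI)
  show "\<one>\<^bsub>knot_group\<^esub> \<in> carrier knot_group"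
    by (simp add: carrier_knot_group one_knot_group)
next
  fix x assume "x \<in> carrier knot_group"
  then obtain u where u: "x = word_class u" by (auto simp: carrier_knot_group)
  then show "\<one>\<^bsub>knot_group\<^esub> \<otimes>\<^bsub>knot_group\<^esub> x = x"
    by (simp add: one_knot_group mult_word_class)
  have "word_class (inv_word u) \<otimes>\<^bsub>knot_group\<^esub> x = \<one>\<^bsub>knot_group\<^esub>"
    by (simp add: u one_knot_group mult_word_class word_class_eq_iff knot_eq_inv_word)
  then show "\<exists>y\<in>carrier knot_group. y \<otimes>\<^bsub>knot_group\<^esub> x = \<one>\<^bsub>knot_group\<^esub>"
    by (auto simp: carrier_knot_group)
qed (auto simp: carrier_knot_group mult_word_class)

section \<open>Matrices of size two and the group \<open>SL2C\<close>\<close>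

lemma mat2_eq_iff:
  "A = B \<longleftrightarrow> A $ 1 $ 1 = B $ 1 $ 1 \<and> A $ 1 $ 2 = B $ 1 $ 2 \<and> A $ 2 $ 1 = B $ 2 $ 1 \<and> A $ 2 $ 2 = B $ 2 $ 2"
  for A B :: mat2
  by (auto simp: vec_eq_iff forall_2)

lemma mat2_mult_nth: "(A ** B) $ i $ j = A $ i $ 1 * B $ 1 $ j + A $ i $ 2 * B $ 2 $ j"
  for A B :: mat2
  by (simp add: matrix_matrix_mult_def sum_2)

lemma mat2_one_nth: "(mat 1 :: mat2) $ 1 $ 1 = 1" "(mat 1 :: mat2) $ 1 $ 2 = 0"
  "(mat 1 :: mat2) $ 2 $ 1 = 0" "(mat 1 :: mat2) $ 2 $ 2 = 1"
  by (simp_all add: mat_def)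

lemma trace_mat2: "trace A = A $ 1 $ 1 + A $ 2 $ 2" for A :: mat2
  by (simp add: trace_def sum_2)

text \<open>The adjugate, which is the inverse in determinant one and is linear in the
  entries.\<close>

definition adj2 :: "mat2 \<Rightarrow> mat2" where
  "adj2 A = vector [vector [A $ 2 $ 2, - A $ 1 $ 2], vector [- A $ 2 $ 1, A $ 1 $ 1]]"

lemma adj2_nth [simp]: "adj2 A $ 1 $ 1 = A $ 2 $ 2" "adj2 A $ 1 $ 2 = - A $ 1 $ 2"
  "adj2 A $ 2 $ 1 = - A $ 2 $ 1" "adj2 A $ 2 $ 2 = A $ 1 $ 1"
  by (simp_all add: adj2_def)

lemma SL2C_simps [simp]: "A \<in> carrier SL2C \<longleftrightarrow> det A = 1" "A \<otimes>\<^bsub>SL2C\<^esub> B = A ** B"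
  "\<one>\<^bsub>SL2C\<^esub> = mat 1"
  by (simp_all add: SL2C_def)

lemma adj2_mult:
  assumes "det A = 1"
  shows "adj2 A ** A = mat 1" "A ** adj2 A = mat 1" "det (adj2 A) = 1"
  using assms by (auto simp: mat2_eq_iff mat2_mult_nth mat2_one_nth det_2 algebra_simps)

lemma group_SL2C: "group SL2C"
proof (rule groupI)
  fix A assume "A \<in> carrier SL2C"
  then show "\<exists>y\<in>carrier SL2C. y \<otimes>\<^bsub>SL2C\<^esub> A = \<one>\<^bsub>SL2C\<^esub>"
    using adj2_mult[of A] by auto
qed (auto simp: det_mul matrix_mul_assoc)

lemma inv_SL2C: "det A = 1 \<Longrightarrow> inv\<^bsub>SL2C\<^esub> A = adj2 A"
  using group.inv_equality[OF group_SL2C, of "adj2 A" A] adj2_mult[of A] by simp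

lemma pm_one_rcos: "pm_one #>\<^bsub>SL2C\<^esub> A = {A, - A}"
  by (auto simp: pm_one_def r_coset_def mat2_eq_iff mat2_mult_nth mat2_one_nth)

lemma pm_one_rcos_eq: "pm_one #>\<^bsub>SL2C\<^esub> A = pm_one #>\<^bsub>SL2C\<^esub> mat 1 \<longleftrightarrow> A = mat 1 \<or> A = - mat 1"
  unfolding pm_one_rcos by (auto simp: doubleton_eq_iff)

section \<open>Elliptic elements\<close>

lemma SL2C_act_uminus: "SL2C_act (- A) x = SL2C_act A x"
proof -
  have "(- u) * cnj (- v) = u * cnj v" "cmod (- u - v) = cmod (u + v)" for u v
    by (simp_all add: norm_minus_cancel[of "u + v", symmetric] del: norm_minus_cancel)
  then show ?thesis
    by (simp add: SL2C_act_def Let_def split: prod.splits)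
       (simp add: algebra_simps)
qed

lemma PSL2C_act_rcos: "PSL2C_act (pm_one #>\<^bsub>SL2C\<^esub> A) x = SL2C_act A x"
proof -
  have "(SOME B. B \<in> {A, - A}) \<in> {A, - A}" by (rule someI) auto
  then show ?thesis unfolding PSL2C_act_def pm_one_rcos
    by (metis SL2C_act_uminus insert_iff singletonD)
qed

text \<open>Such a matrix is a rotation or scalar-free elliptic motion about a geodesic, and one
  point of the axis is written down explicitly.\<close>

lemma elliptic_fixed_point:
  assumes "det A = 1" "trace A = of_real \<tau>" "\<bar>\<tau>\<bar> < 2"
  shows "\<exists>x\<in>H3. SL2C_act A x = x"
proof -
  define a b c d where abcd: "a = A $ 1 $ 1" "b = A $ 1 $ 2" "c = A $ 2 $ 1" "d = A $ 2 $ 2"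
  have det: "a * d - b * c = 1" and tr: "a + d = of_real \<tau>"
    using assms(1,2) by (simp_all add: abcd det_2 trace_mat2)
  have tau: "\<tau>\<^sup>2 < 4" using power_strict_mono[OF assms(3), of 2] by simp
  show ?thesis
  proof (cases "c = 0")
    case True
    define u v where "u = Re a" and "v = Im a"
    have a: "a = Complex u v" by (simp add: u_def v_def)
    have d: "d = Complex (\<tau> - u) (- v)" using tr by (simp add: u_def v_def complex_eq_iff)
    have "u * (\<tau> - u) + v * v = 1" "v * (\<tau> - 2 * u) = 0"
      using det True unfolding a d by (simp_all add: complex_eq_iff algebra_simps)
    moreover have "v \<noteq> 0"
    proof
      assume "v = 0"
      then have "(2 * u - \<tau>)\<^sup>2 = \<tau>\<^sup>2 - 4"
        using calculation(1) by (simp add: power2_eq_square algebra_simps)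
      then show False using tau by (metis diff_less_0_iff_less not_less zero_le_power2)
    qed
    ultimately have v: "\<tau> = 2 * u" "u * u + v * v = 1" "v \<noteq> 0" by auto
    \<comment> \<open>The diagonal entries are conjugate of modulus one; the axis is the vertical
      line above \<open>b / (d - a)\<close>.\<close>
    have d: "d = cnj a" using d v by (simp add: complex_eq_iff u_def v_def)
    have da: "d - a \<noteq> 0" using v by (simp add: d complex_eq_iff v_def)
    have "(cmod d)\<^sup>2 = (cmod a)\<^sup>2" by (simp add: d)
    also have "\<dots> = u\<^sup>2 + v\<^sup>2" by (simp add: cmod_power2 u_def v_def)
    finally have n: "(cmod d)\<^sup>2 = 1" using v by (simp add: power2_eq_square)
    have "(a * (b / (d - a)) + b) * a = b / (d - a)"
    proof -
      have "(a * (b / (d - a)) + b) * a = b * (a * d) / (d - a)"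
        using da by (simp add: field_simps)
      then show ?thesis using det True by simp
    qed
    then have "SL2C_act A (b / (d - a), 1) = (b / (d - a), 1)"
      unfolding SL2C_act_def Let_def using True n d by (simp add: abcd(1-4)[symmetric])
    then show ?thesis by (intro bexI[of _ "(b / (d - a), 1)"]) (auto simp: H3_def)
  next
    case False
    \<comment> \<open>The top of the semicircular axis: its ends are the roots of
      \<open>c X^2 + (d - a) X - b\<close>, with midpoint \<open>z\<close> and half distance
      \<open>t\<close>.\<close>
    define z t where "z = (a - d) / (2 * c)" and "t = sqrt (4 - \<tau>\<^sup>2) / (2 * cmod c)"
    have t: "t > 0" using tau False by (simp add: t_def)
    have t2: "t\<^sup>2 * (cmod c)\<^sup>2 = (4 - \<tau>\<^sup>2) / 4"
      using tau False by (simp add: t_def power_divide power_mult_distrib)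
    have "2 * (c * z + d) = a + d" using False by (simp add: z_def field_simps)
    then have czd: "c * z + d = of_real (\<tau> / 2)" unfolding tr by (simp add: field_simps)
    have n: "(cmod (c * z + d))\<^sup>2 + (cmod c)\<^sup>2 * t\<^sup>2 = 1"
      unfolding czd norm_of_real using t2 by (simp add: power_divide field_simps)
    have "2 * c * (a * z + b) = a * (a - d) + 2 * (b * c)"
      using False by (simp add: z_def field_simps)
    also have "\<dots> = a * of_real \<tau> - 2" using det tr by algebra
    finally have azb: "2 * c * (a * z + b) = a * of_real \<tau> - 2" .
    have "c * cnj c * of_real (t\<^sup>2) = of_real (t\<^sup>2 * (cmod c)\<^sup>2)"
      by (simp add: complex_norm_square[symmetric] mult.commute del: of_real_power)
    also have "\<dots> = (4 - (of_real \<tau>)\<^sup>2) / 4" unfolding t2 by simp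
    finally have ct: "c * cnj c * of_real (t\<^sup>2) = (4 - (of_real \<tau>)\<^sup>2) / 4" .
    have "4 * c * ((a * z + b) * of_real (\<tau> / 2) + a * cnj c * of_real (t\<^sup>2))
        = (2 * c * (a * z + b)) * of_real \<tau> + a * (4 * (c * cnj c * of_real (t\<^sup>2)))"
      by (simp add: algebra_simps)
    also have "\<dots> = 4 * a - 2 * of_real \<tau>"
      unfolding azb ct by (simp add: power2_eq_square field_simps)
    also have "\<dots> = 4 * c * z"
      using False by (simp add: z_def tr[symmetric] field_simps)
    finally have fix_z: "(a * z + b) * of_real (\<tau> / 2) + a * cnj c * of_real (t\<^sup>2) = z"
      using False by simp
    have cnj: "cnj (c * z + d) = of_real (\<tau> / 2)" unfolding czd by simp
    have "SL2C_act A (z, t) = (z, t)"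
      unfolding SL2C_act_def Let_def abcd(1-4)[symmetric] prod.case n cnj fix_z by simp
    then show ?thesis using t by (intro bexI[of _ "(z, t)"]) (auto simp: H3_def)
  qed
qed

section \<open>The longitude\<close>

text \<open>Computations take place in the basis \<open>1, A, B, AB\<close> of the quaternion algebra
  generated by \<open>A\<close> and \<open>B\<close>.\<close>

definition quat :: "mat2 \<Rightarrow> mat2 \<Rightarrow> complex \<Rightarrow> complex \<Rightarrow> complex \<Rightarrow> complex \<Rightarrow> mat2" where
  "quat A B c0 c1 c2 c3 =
    (\<chi> i j. c0 * mat 1 $ i $ j + c1 * A $ i $ j + c2 * B $ i $ j + c3 * (A ** B) $ i $ j)"

lemma quat_eqI: "c0 = d0 \<Longrightarrow> c1 = d1 \<Longrightarrow> c2 = d2 \<Longrightarrow> c3 = d3 \<Longrightarrow>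
    quat A B c0 c1 c2 c3 = quat A B d0 d1 d2 d3"
  by simp

locale sl2_pair =
  fixes A B :: mat2 and z r :: complex
  assumes det_A: "det A = 1" and det_B: "det B = 1"
    and tr_A: "trace A = z" and tr_B: "trace B = z"
    and tr_AB: "trace (A ** adj2 B) = r"
begin

lemma diag: "A $ 2 $ 2 = z - A $ 1 $ 1" "B $ 2 $ 2 = z - B $ 1 $ 1"
proof -
  show "A $ 2 $ 2 = z - A $ 1 $ 1" unfolding tr_A[symmetric] by (simp add: trace_mat2)
  show "B $ 2 $ 2 = z - B $ 1 $ 1" unfolding tr_B[symmetric] by (simp add: trace_mat2)
qed

abbreviation "Q \<equiv> quat A B"

text \<open>Cayley-Hamilton gives \<open>A^2 = z A - 1\<close>, and its polarization together with
  \<open>tr(AB) = z^2 - r\<close> gives \<open>B A = -r + z A + z B - A B\<close>.\<close>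

lemma quat_mult_A:
  "Q c0 c1 c2 c3 ** A
    = Q (- c1 - r * c2 - z * c3) (c0 + z * c1 + z * c2 + (z\<^sup>2 - r) * c3) (z * c2 + c3) (- c2)"
proof -
  define a b c e f g where v: "a = A $ 1 $ 1" "b = A $ 1 $ 2" "c = A $ 2 $ 1"
    "e = B $ 1 $ 1" "f = B $ 1 $ 2" "g = B $ 2 $ 1"
  have d: "A $ 2 $ 2 = z - a" "B $ 2 $ 2 = z - e"
    by (simp_all add: diag v)
  have "a * (z - a) - b * c = 1" "e * (z - e) - f * g = 1"
    using det_A det_B by (simp_all add: det_2 v(1-6)[symmetric] d)
  moreover have "a * (z - e) - b * g - c * f + (z - a) * e = r"
    unfolding tr_AB[symmetric] by (simp add: trace_mat2 mat2_mult_nth v(1-6)[symmetric] d)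
  ultimately have h: "a * (z - a) - b * c = 1" "e * (z - e) - f * g = 1"
    "a * (z - e) - b * g - c * f + (z - a) * e = r" .
  show ?thesis
    unfolding mat2_eq_iff mat2_mult_nth
    by (simp add: quat_def mat2_mult_nth mat2_one_nth v(1-6)[symmetric] d; intro conjI; use h in algebra)
qed

lemma quat_mult_B:
  "Q c0 c1 c2 c3 ** B = Q (- c2) (- c3) (c0 + z * c2) (c1 + z * c3)"
proof -
  define a b c e f g where v: "a = A $ 1 $ 1" "b = A $ 1 $ 2" "c = A $ 2 $ 1"
    "e = B $ 1 $ 1" "f = B $ 1 $ 2" "g = B $ 2 $ 1"
  have d: "A $ 2 $ 2 = z - a" "B $ 2 $ 2 = z - e"
    by (simp_all add: diag v)
  have h: "e * (z - e) - f * g = 1"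
    using det_B by (simp add: det_2 v(1-6)[symmetric] d)
  show ?thesis
    unfolding mat2_eq_iff mat2_mult_nth
    by (simp add: quat_def mat2_mult_nth mat2_one_nth v(1-6)[symmetric] d; intro conjI; use h in algebra)
qed

lemma quat_mult_lin: "(M :: mat2) ** Q d0 d1 d2 d3 = (\<chi> i j. d0 * M $ i $ j + d1 * (M ** A) $ i $ j
    + d2 * (M ** B) $ i $ j + d3 * (M ** A ** B) $ i $ j)"
  unfolding mat2_eq_iff by (simp add: quat_def mat2_mult_nth mat2_one_nth algebra_simps)

lemma quat_mult:
  "Q c0 c1 c2 c3 ** Q d0 d1 d2 d3 = Q
    (d0 * c0 + d1 * (- c1 - r * c2 - z * c3) - d2 * c2 - d3 * (z * c2 + c3))
    (d0 * c1 + d1 * (c0 + z * c1 + z * c2 + (z\<^sup>2 - r) * c3) - d2 * c3 + d3 * c2)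
    (d0 * c2 + d1 * (z * c2 + c3) + d2 * (c0 + z * c2)
      + d3 * (- c1 - r * c2 - z * c3 + z * (z * c2 + c3)))
    (d0 * c3 - d1 * c2 + d2 * (c1 + z * c3)
      + d3 * (c0 + z * c1 + z * c2 + (z\<^sup>2 - r) * c3 - z * c2))"
  unfolding quat_mult_lin quat_mult_A quat_mult_B
  by (simp add: mat2_eq_iff quat_def algebra_simps)

lemma quat_gens: "A = Q 0 1 0 0" "B = Q 0 0 1 0" "adj2 A = Q z (- 1) 0 0" "adj2 B = Q z 0 (- 1) 0"
  by (simp_all add: mat2_eq_iff quat_def mat2_one_nth diag)

lemma A_adj_B: "A ** adj2 B = Q 0 z 0 (- 1)"
proof -
  have "A ** adj2 B = Q 0 1 0 0 ** Q z 0 (- 1) 0" by (simp only: quat_gens[symmetric])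
  also have "\<dots> = Q 0 z 0 (- 1)" unfolding quat_mult by (simp add: power2_eq_square)
  finally show ?thesis .
qed

lemma adj_A_B: "adj2 A ** B = Q 0 0 z (- 1)"
proof -
  have "adj2 A ** B = Q z (- 1) 0 0 ** Q 0 0 1 0" by (simp only: quat_gens[symmetric])
  also have "\<dots> = Q 0 0 z (- 1)" unfolding quat_mult by (simp add: power2_eq_square)
  finally show ?thesis .
qed

lemma B_adj_A: "B ** adj2 A = Q r (- z) 0 1"
proof -
  have "B ** adj2 A = Q 0 0 1 0 ** Q z (- 1) 0 0" by (simp only: quat_gens[symmetric])
  also have "\<dots> = Q r (- z) 0 1" unfolding quat_mult by (simp add: power2_eq_square)
  finally show ?thesis .
qed

lemma adj_B_A: "adj2 B ** A = Q r 0 (- z) 1"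
proof -
  have "adj2 B ** A = Q z 0 (- 1) 0 ** Q 0 1 0 0" by (simp only: quat_gens[symmetric])
  also have "\<dots> = Q r 0 (- z) 1" unfolding quat_mult by (simp add: power2_eq_square)
  finally show ?thesis .
qed

lemma w_eq: "A ** adj2 B ** (A ** adj2 B) ** (adj2 A ** B ** (adj2 A ** B))
    = Q (1 - r\<^sup>2) (z * (r\<^sup>2 - r)) (z * (r\<^sup>2 - r)) (2 * r - r ^ 3)"
  unfolding A_adj_B adj_A_B quat_mult by (rule quat_eqI; algebra)

lemma rev_w_eq: "B ** adj2 A ** (B ** adj2 A) ** (adj2 B ** A ** (adj2 B ** A))
    = Q (1 - 3 * r\<^sup>2 + r ^ 4) (z * (r + r\<^sup>2 - r ^ 3)) (z * (r + r\<^sup>2 - r ^ 3)) (r ^ 3 - 2 * r)"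
  unfolding B_adj_A adj_B_A quat_mult by (rule quat_eqI; algebra)

text \<open>The curve equation eliminates \<open>r^2 z^2\<close>. That the last two coordinates
  vanish reflects the fact that the longitude commutes with \<open>a\<close>.\<close>

lemma longitude_eq:
  fixes W W' :: mat2
  defines "W \<equiv> A ** adj2 B ** (A ** adj2 B) ** (adj2 A ** B ** (adj2 A ** B))"
    and "W' \<equiv> B ** adj2 A ** (B ** adj2 A) ** (adj2 B ** A ** (adj2 B ** A))"
  assumes curve: "r ^ 3 - r\<^sup>2 * z\<^sup>2 + 2 * r\<^sup>2 - 1 = 0"
  shows "W ** W ** (W' ** W')
    = Q (1 - 2 * r + 3 * r\<^sup>2 + 3 * r ^ 3 - 4 * r ^ 4 - r ^ 5 + r ^ 6)
        (z * r ^ 3 * (- 4 + 2 * r + 2 * r\<^sup>2 - r ^ 3)) 0 0"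
proof -
  have WW: "W ** W = Q (- 1 + r - r ^ 3) (z * (r ^ 3 - r\<^sup>2)) (z * (r ^ 3 - r\<^sup>2)) (2 * r\<^sup>2 - r ^ 4)"
    unfolding W_def w_eq quat_mult by (rule quat_eqI; use curve in algebra)
  have WW': "W' ** W' = Q (- 1 + r - 3 * r ^ 3 + r ^ 5) (z * (r\<^sup>2 + r ^ 3 - r ^ 4))
      (z * (r\<^sup>2 + r ^ 3 - r ^ 4)) (r ^ 4 - 2 * r\<^sup>2)"
    unfolding W'_def rev_w_eq quat_mult by (rule quat_eqI; use curve in algebra)
  show ?thesis
    unfolding WW WW' quat_mult
    by (rule quat_eqI; (algebra | use curve in algebra))
qed

end

section \<open>Representations of the knot group\<close>

text \<open>The nonzero columns of \<open>N\<close> are eigenvectors of \<open>X\<close> for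
  \<open>k\<close>. A single \<open>N\<close> can serve both \<open>A\<close> and the longitude,
  which lies in the span of \<open>1\<close> and \<open>A\<close>.\<close>

definition acts_as :: "mat2 \<Rightarrow> mat2 \<Rightarrow> complex \<Rightarrow> bool" where
  "acts_as N X k \<longleftrightarrow> (\<forall>i j. (X ** N) $ i $ j = k * N $ i $ j)"

lemma acts_as_one: "acts_as N (mat 1) 1" "acts_as N (- mat 1) (- 1)"
  by (simp_all add: acts_as_def forall_2 mat2_mult_nth mat2_one_nth)

lemma acts_as_mult:
  assumes "acts_as N X k" "acts_as N Y l"
  shows "acts_as N (X ** Y) (k * l)"
proof -
  have "((X ** Y) ** N) $ i $ j = X $ i $ 1 * (Y ** N) $ 1 $ j + X $ i $ 2 * (Y ** N) $ 2 $ j" for i j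
    by (simp add: matrix_mul_assoc[symmetric] mat2_mult_nth)
  also have "\<dots> i j = l * (X ** N) $ i $ j" for i j
    using assms(2) by (simp add: acts_as_def mat2_mult_nth[of X N] algebra_simps)
  finally show ?thesis using assms(1) by (simp add: acts_as_def)
qed

lemma acts_as_unique:
  assumes "N \<noteq> 0" "acts_as N X k" "acts_as N X l"
  shows "k = l"
proof -
  obtain i j where "N $ i $ j \<noteq> 0" using assms(1) by (auto simp: vec_eq_iff)
  moreover have "k * N $ i $ j = l * N $ i $ j" using assms(2,3) unfolding acts_as_def by metis
  ultimately show ?thesis by simp
qed

lemma acts_as_adj2:
  assumes "N \<noteq> 0" "det X = 1" "acts_as N X k"
  shows "k \<noteq> 0" "acts_as N (adj2 X) (inverse k)"
proof -
  have N: "N = adj2 X ** (X ** N)"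
    using adj2_mult[OF assms(2)] by (simp add: matrix_mul_assoc)
  have X: "(X ** N) $ i $ j = k * N $ i $ j" for i j using assms(3) by (simp add: acts_as_def)
  have eq: "N $ i $ j = k * (adj2 X ** N) $ i $ j" for i j
    by (subst N) (simp add: mat2_mult_nth[of "adj2 X"] X algebra_simps)
  show k: "k \<noteq> 0" using eq assms(1) by (auto simp: vec_eq_iff)
  show "acts_as N (adj2 X) (inverse k)"
    unfolding acts_as_def using eq k by simp
qed

lemma acts_as_int_pow:
  assumes "N \<noteq> 0" "det X = 1" "acts_as N X k"
  shows "acts_as N (X [^]\<^bsub>SL2C\<^esub> (n :: int)) (k powi n)"
proof -
  interpret group SL2C by (rule group_SL2C)
  have nat: "acts_as N (X [^]\<^bsub>SL2C\<^esub> (m :: nat)) (k ^ m)" for m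
  proof (induction m)
    case 0
    then show ?case using acts_as_one by simp
  next
    case (Suc m)
    then show ?case using acts_as_mult[OF Suc assms(3)] by (simp add: mult.commute)
  qed
  have det: "det (X [^]\<^bsub>SL2C\<^esub> (m :: nat)) = 1" for m
    using nat_pow_closed[of X m] assms(2) by simp
  show ?thesis
  proof (cases "n < 0")
    case True
    then have "X [^]\<^bsub>SL2C\<^esub> n = adj2 (X [^]\<^bsub>SL2C\<^esub> nat (- n))"
      by (simp only: int_pow_def2 if_True inv_SL2C[OF det])
    moreover have "k powi n = inverse (k ^ nat (- n))"
      using True by (simp add: power_int_def power_inverse)
    ultimately show ?thesis using acts_as_adj2(2)[OF assms(1) det nat] by metis
  next
    case False
    then have "X [^]\<^bsub>SL2C\<^esub> n = X [^]\<^bsub>SL2C\<^esub> nat n"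
      by (simp only: int_pow_def2 if_False)
    moreover have "k powi n = k ^ nat n" using False by (simp add: power_int_def)
    ultimately show ?thesis using nat by metis
  qed
qed

section \<open>The matrices of the generators and of the longitude\<close>

locale knot_rep =
  fixes \<rho> :: "word set \<Rightarrow> mat2"
  assumes hom: "\<rho> \<in> hom knot_group SL2C"
begin

sublocale group_hom knot_group SL2C \<rho>
  using hom group_knot_group group_SL2C by (simp add: group_hom_def group_hom_axioms_def)

definition \<phi> :: "word \<Rightarrow> mat2" where "\<phi> u = \<rho> (word_class u)"

lemma phi_append: "\<phi> (u @ v) = \<phi> u ** \<phi> v"
  using hom_mult[of "word_class u" "word_class v"]
  by (simp add: \<phi>_def carrier_knot_group mult_word_class)

lemma phi_Nil: "\<phi> [] = mat 1"
  using hom_one by (simp add: \<phi>_def one_knot_group)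

lemma phi_Cons: "\<phi> (l # m # u) = \<phi> [l] ** \<phi> (m # u)"
  using phi_append[of "[l]" "m # u"] by simp

lemma det_phi: "det (\<phi> u) = 1"
  using hom_closed[of "word_class u"] by (simp add: \<phi>_def carrier_knot_group)

lemma phi_cong: "knot_eq u v \<Longrightarrow> \<phi> u = \<phi> v"
  by (simp add: \<phi>_def word_class_eq_iff[symmetric])

lemma phi_inverse: "\<phi> [(g, False)] = adj2 (\<phi> [(g, True)])"
proof -
  have "\<phi> [(g, False)] ** \<phi> [(g, True)] = mat 1"
    using phi_cong[OF knot_eq.cancel[of g False]] by (simp add: phi_Cons phi_Nil)
  then have "inv\<^bsub>SL2C\<^esub> (\<phi> [(g, True)]) = \<phi> [(g, False)]"
    by (intro H.inv_equality) (auto simp: det_phi)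
  then show ?thesis by (simp add: inv_SL2C det_phi)
qed

definition A where "A = \<phi> [la]"
definition B where "B = \<phi> [lb]"
definition Z where "Z = trace A"
definition R where "R = trace (\<phi> [la, lB])"

lemma phi_letters: "\<phi> [la] = A" "\<phi> [lb] = B" "\<phi> [lA] = adj2 A" "\<phi> [lB] = adj2 B"
  by (simp_all add: A_def B_def phi_inverse)

lemma phi_a_inv_b: "\<phi> [la, lB] = A ** adj2 B"
  by (simp add: phi_Cons phi_letters)

text \<open>The defining relation conjugates \<open>b\<close> to \<open>a\<close> by
  \<open>w^2\<close>.\<close>

lemma trace_B: "trace B = Z"
proof -
  define V where "V = \<phi> (knot_w @ knot_w)"
  have V: "V ** adj2 V = mat 1" using adj2_mult(2)[OF det_phi] by (simp add: V_def)
  have "A ** V = V ** B"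
    using phi_cong[OF knot_eq.relation]
    by (simp only: phi_append V_def matrix_mul_assoc phi_letters)
  then have "A = V ** (B ** adj2 V)"
    using V by (metis matrix_mul_assoc matrix_mul_rid)
  then have "trace A = trace (V ** (B ** adj2 V))" by simp
  also have "\<dots> = trace ((B ** adj2 V) ** V)" by (rule trace_mul_sym)
  also have "\<dots> = trace B"
    using adj2_mult(1)[OF det_phi, of "knot_w @ knot_w"]
    by (simp add: matrix_mul_assoc[symmetric] V_def)
  finally show ?thesis by (simp add: Z_def)
qed

sublocale sl2_pair A B Z R
  by unfold_locales
    (simp_all add: A_def B_def det_phi Z_def R_def phi_a_inv_b trace_B[unfolded B_def Z_def A_def]
      flip: phi_letters)

lemma char_point_eq: "char_point \<rho> = (R, Z)"
  by (simp add: char_point_def R_def Z_def A_def \<phi>_def)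

lemma longitude_rep:
  assumes "R ^ 3 - R\<^sup>2 * Z\<^sup>2 + 2 * R\<^sup>2 - 1 = 0"
  shows "\<rho> longitude = Q (1 - 2 * R + 3 * R\<^sup>2 + 3 * R ^ 3 - 4 * R ^ 4 - R ^ 5 + R ^ 6)
        (Z * R ^ 3 * (- 4 + 2 * R + 2 * R\<^sup>2 - R ^ 3)) 0 0"
proof -
  have "\<phi> knot_w = A ** adj2 B ** (A ** adj2 B) ** (adj2 A ** B ** (adj2 A ** B))"
    by (simp add: knot_w_def phi_Cons phi_letters matrix_mul_assoc)
  moreover have "\<phi> (rev knot_w) = B ** adj2 A ** (B ** adj2 A) ** (adj2 B ** A ** (adj2 B ** A))"
    by (simp add: knot_w_def phi_Cons phi_letters matrix_mul_assoc)
  ultimately have "\<phi> (knot_w @ knot_w @ rev (knot_w @ knot_w)) = Q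
      (1 - 2 * R + 3 * R\<^sup>2 + 3 * R ^ 3 - 4 * R ^ 4 - R ^ 5 + R ^ 6)
      (Z * R ^ 3 * (- 4 + 2 * R + 2 * R\<^sup>2 - R ^ 3)) 0 0"
    using longitude_eq[OF assms] by (simp add: phi_append matrix_mul_assoc)
  then show ?thesis by (simp add: \<phi>_def longitude_def)
qed

text \<open>If \<open>R\<close> vanishes at a place then the eigenvalue of the meridian has a pole there while that
  of the longitude reduces to \<open>1\<close>: the ideal points over \<open>R = 0\<close> have boundary slope \<open>0\<close>.\<close>

lemma slope_zero:
  fixes p q :: int
  assumes curve: "R ^ 3 - R\<^sup>2 * Z\<^sup>2 + 2 * R\<^sup>2 - 1 = 0"
    and V: "valuation_ring V" and RV: "inverse R \<notin> V"
    and rel: "A [^]\<^bsub>SL2C\<^esub> p ** \<rho> longitude [^]\<^bsub>SL2C\<^esub> q \<in> pm_one"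
  shows "p = 0"
proof (rule ccontr)
  assume p0: "p \<noteq> 0"
  interpret V: valuation_ring V by fact
  have R: "R \<in> V" using V.total RV by blast
  have ZV: "Z \<notin> V"
  proof
    assume Z: "Z \<in> V"
    have "R * (R * Z\<^sup>2 - R\<^sup>2 - 2 * R) = - 1" using curve by algebra
    then have "R * (R\<^sup>2 + 2 * R - R * Z\<^sup>2) = 1" by algebra
    then have "inverse R = R\<^sup>2 + 2 * R - R * Z\<^sup>2" by (rule inverse_unique)
    also have "\<dots> \<in> V" using R Z by (intro V.closed)
    finally show False using RV by blast
  qed
  \<comment> \<open>The eigenvalues of \<open>A\<close>: their sum \<open>Z\<close> has a pole, so
    one of them, called \<open>\<mu>\<close>, does, and its inverse \<open>\<mu>'\<close> lies in
    the maximal ideal.\<close>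
  obtain \<mu> \<mu>' where mu: "\<mu> + \<mu>' = Z" "\<mu> * \<mu>' = 1" "\<mu> \<notin> V"
  proof -
    define s where "s = csqrt (Z\<^sup>2 - 4)"
    have "s\<^sup>2 = Z\<^sup>2 - 4" by (simp add: s_def)
    then have 1: "(Z + s) / 2 + (Z - s) / 2 = Z" "((Z + s) / 2) * ((Z - s) / 2) = 1"
      by (simp_all add: field_simps power2_eq_square)
    have "(Z + s) / 2 \<notin> V \<or> (Z - s) / 2 \<notin> V" using V.add_closed 1(1) ZV by metis
    then show ?thesis
      using that[of "(Z + s) / 2" "(Z - s) / 2"] that[of "(Z - s) / 2" "(Z + s) / 2"] 1
      by (auto simp: add.commute mult.commute)
  qed
  have inv_mu: "inverse \<mu> = \<mu>'" "inverse \<mu>' = \<mu>" using mu(2) inverse_unique by (metis mult.commute)+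
  then have mu': "\<mu>' \<in> V" using V.total mu(3) by metis
  \<comment> \<open>\<open>N = A - \<mu>'\<close>, whose columns are killed by
    \<open>A - \<mu>\<close> by Cayley-Hamilton. It is nonzero, since otherwise
    \<open>\<mu> = \<mu>'\<close> would lie in \<open>V\<close>.\<close>
  define N where "N = Q (- \<mu>') 1 0 0"
  have N0: "N \<noteq> 0"
  proof
    assume "N = 0"
    then have "N $ 1 $ 1 = 0" "N $ 2 $ 2 = 0" by simp_all
    then have "A $ 1 $ 1 = \<mu>'" "A $ 2 $ 2 = \<mu>'"
      by (simp_all add: N_def quat_def mat2_one_nth)
    then have "\<mu> + \<mu>' = \<mu>' + \<mu>'" using mu(1) by (simp add: Z_def trace_mat2)
    then show False using mu(3) mu' by simp
  qed
  have acts: "acts_as N (Q c d 0 0) (c + d * \<mu>)" for c d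
  proof -
    have "Q c d 0 0 ** N = Q (- (c * \<mu>') - d) (d * (- \<mu>' + Z) + c) 0 0"
      unfolding N_def quat_mult by (rule quat_eqI) (simp_all add: algebra_simps)
    also have "- (c * \<mu>') - d = (c + d * \<mu>) * (- \<mu>')" using mu(2) by algebra
    also have "d * (- \<mu>' + Z) + c = c + d * \<mu>"
      unfolding mu(1)[symmetric] by (simp add: algebra_simps)
    finally show ?thesis by (simp add: acts_as_def N_def quat_def algebra_simps)
  qed
  define \<alpha> \<beta> where "\<alpha> = 1 - 2 * R + 3 * R\<^sup>2 + 3 * R ^ 3 - 4 * R ^ 4 - R ^ 5 + R ^ 6"
    and "\<beta> = Z * R ^ 3 * (- 4 + 2 * R + 2 * R\<^sup>2 - R ^ 3)"
  define \<kappa> where "\<kappa> = \<alpha> + \<beta> * \<mu>"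
  have L: "\<rho> longitude = Q \<alpha> \<beta> 0 0" unfolding \<alpha>_def \<beta>_def by (rule longitude_rep[OF curve])
  have det_L: "det (\<rho> longitude) = 1"
    using hom_closed[of longitude] by (simp add: carrier_knot_group longitude_def)
  have actL: "acts_as N (\<rho> longitude) \<kappa>" unfolding L \<kappa>_def by (rule acts)
  have "acts_as N A \<mu>" using acts[of 0 1] quat_gens(1) by simp
  from acts_as_mult[OF acts_as_int_pow[OF N0 _ this] acts_as_int_pow[OF N0 det_L actL], of p q]
  have act: "acts_as N (A [^]\<^bsub>SL2C\<^esub> p ** \<rho> longitude [^]\<^bsub>SL2C\<^esub> q) (\<mu> powi p * \<kappa> powi q)"
    by (simp add: A_def det_phi)
  have eps: "\<mu> powi p * \<kappa> powi q = 1 \<or> \<mu> powi p * \<kappa> powi q = - 1"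
    using rel acts_as_unique[OF N0 act] acts_as_one by (auto simp: pm_one_def)
  \<comment> \<open>From \<open>Z = \<mu> (1 + \<mu>'^2)\<close> the product
    \<open>R^2 Z \<mu>\<close> equals \<open>R^2 Z^2\<close> times the unit \<open>u\<close>, hence
    is integral by the curve equation although \<open>Z\<close> and \<open>\<mu>\<close> have
    poles.\<close>
  define u where "u = inverse (1 + \<mu>' * \<mu>')"
  have u: "1 + \<mu>' * \<mu>' \<noteq> 0" "u \<in> V"
    using V.unit_one_plus[of \<mu>' \<mu>'] mu' mu(3) inv_mu unfolding u_def by auto
  have "\<mu> * (1 + \<mu>' * \<mu>') = \<mu> + \<mu> * \<mu>' * \<mu>'" by algebra
  also have "\<dots> = Z" using mu(1,2) by simp
  finally have "R\<^sup>2 * Z * \<mu> * (1 + \<mu>' * \<mu>') = R\<^sup>2 * Z * Z" by (simp add: mult.assoc)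
  also have "\<dots> = R ^ 3 + 2 * R\<^sup>2 - 1" using curve by algebra
  finally have "R\<^sup>2 * Z * \<mu> * (1 + \<mu>' * \<mu>') = R ^ 3 + 2 * R\<^sup>2 - 1" .
  then have RZ: "R\<^sup>2 * Z * \<mu> = (R ^ 3 + 2 * R\<^sup>2 - 1) * u" using u(1) by (simp add: u_def field_simps)
  define y where "y = - 2 + 3 * R + 3 * R\<^sup>2 - 4 * R ^ 3 - R ^ 4 + R ^ 5
      + (R ^ 3 + 2 * R\<^sup>2 - 1) * u * (2 * R + 2 * R\<^sup>2 - 4 - R ^ 3)"
  have y: "y \<in> V" using R u unfolding y_def by (intro V.closed)
  have lam: "\<kappa> = 1 + R * y"
    unfolding \<kappa>_def \<alpha>_def \<beta>_def y_def RZ[symmetric] by algebra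
  have lam0: "\<kappa> \<noteq> 0" and lamV: "\<kappa> \<in> V" "inverse \<kappa> \<in> V"
    using V.unit_one_plus[OF R RV y] R y unfolding lam by (auto intro: V.closed)
  have powV: "\<kappa> powi k \<in> V" for k
    using lamV by (auto simp: power_int_def intro: V.power_closed)
  have False if "\<mu> ^ Suc n \<in> V" for n
  proof -
    have "\<mu> = \<mu> ^ Suc n * \<mu>' ^ n" using mu(2)
      by (simp add: mult.assoc power_mult_distrib[symmetric])
    also have "\<dots> \<in> V" by (rule V.mult_closed[OF that V.power_closed[OF mu']])
    finally show False using mu(3) by blast
  qed
  then have no_pow: "\<mu> ^ n \<notin> V" if "n > 0" for n using that by (metis gr0_conv_Suc)
  have mu0: "\<mu> \<noteq> 0" using mu(2) by auto
  \<comment> \<open>All powers of the unit \<open>\<kappa>\<close> lie in \<open>V\<close>, but no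
    positive power of \<open>\<mu>\<close> does; the sign of \<open>p\<close> decides which side of
    the relation is inverted.\<close>
  show False
  proof (cases "p > 0")
    case True
    have "\<mu> powi p = \<kappa> powi (- q) \<or> \<mu> powi p = - (\<kappa> powi (- q))"
      using eps lam0 by (auto simp: power_int_minus field_simps minus_equation_iff)
    then have "\<mu> powi p \<in> V" using powV V.uminus_closed by metis
    then show False using no_pow[of "nat p"] True by (simp add: power_int_def)
  next
    case False
    have "\<mu> powi (- p) = \<kappa> powi q \<or> \<mu> powi (- p) = - (\<kappa> powi q)"
      using eps mu0 by (auto simp: power_int_minus field_simps minus_equation_iff)
    then have "\<mu> powi (- p) \<in> V" using powV V.uminus_closed by metis
    then show False using no_pow[of "nat (- p)"] False p0 by (simp add: power_int_def)
  qed
qed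

text \<open>If \<open>\<rho>(longitude) = \<alpha> + \<beta> A\<close> is scalar then \<open>\<beta> = 0\<close>, which is a polynomial equation for \<open>R\<close>.\<close>

lemma zero_surgery:
  assumes curve: "R ^ 3 - R\<^sup>2 * Z\<^sup>2 + 2 * R\<^sup>2 - 1 = 0"
    and V: "valuation_ring V" and RV: "inverse R \<notin> V"
    and L: "\<rho> longitude \<in> pm_one"
  shows "R = 2 \<or> R\<^sup>2 = 2"
proof -
  interpret V: valuation_ring V by fact
  have R: "R \<in> V" using V.total RV by blast
  define \<alpha> \<beta> where "\<alpha> = 1 - 2 * R + 3 * R\<^sup>2 + 3 * R ^ 3 - 4 * R ^ 4 - R ^ 5 + R ^ 6"
    and "\<beta> = Z * R ^ 3 * (- 4 + 2 * R + 2 * R\<^sup>2 - R ^ 3)"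
  have Q: "Q \<alpha> \<beta> 0 0 \<in> pm_one"
    using L longitude_rep[OF curve] unfolding \<alpha>_def \<beta>_def by simp
  have ZR: "Z\<^sup>2 \<noteq> 4"
  proof
    assume "Z\<^sup>2 = 4"
    then have "R ^ 3 - R\<^sup>2 * 4 + 2 * R\<^sup>2 - 1 = 0" using curve by simp
    then have "R * (R\<^sup>2 - 2 * R) = 1" by algebra
    then have "inverse R = R\<^sup>2 - 2 * R" by (rule inverse_unique)
    also have "\<dots> \<in> V" using R by (intro V.closed)
    finally show False using RV by blast
  qed
  \<comment> \<open>For \<open>\<beta> \<noteq> 0\<close> the matrix
    \<open>\<alpha> + \<beta> A\<close> is scalar only if \<open>A\<close> is, and then
    \<open>Z^2 = 4\<close>.\<close>
  have "\<beta> = 0"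
  proof (rule ccontr)
    assume "\<beta> \<noteq> 0"
    moreover have "Q \<alpha> \<beta> 0 0 $ 1 $ 2 = 0" "Q \<alpha> \<beta> 0 0 $ 2 $ 1 = 0" "Q \<alpha> \<beta> 0 0 $ 1 $ 1 = Q \<alpha> \<beta> 0 0 $ 2 $ 2"
      using Q by (auto simp: pm_one_def mat2_one_nth)
    then have "\<beta> * A $ 1 $ 2 = 0" "\<beta> * A $ 2 $ 1 = 0" "\<beta> * A $ 1 $ 1 = \<beta> * A $ 2 $ 2"
      by (simp_all add: quat_def mat2_one_nth)
    ultimately have "A $ 1 $ 2 = 0" "A $ 2 $ 1 = 0" "A $ 1 $ 1 = A $ 2 $ 2" by simp_all
    moreover have "A $ 1 $ 1 * A $ 2 $ 2 - A $ 1 $ 2 * A $ 2 $ 1 = 1" "Z = A $ 1 $ 1 + A $ 2 $ 2"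
      using det_A by (simp_all add: det_2 Z_def trace_mat2)
    ultimately have "A $ 1 $ 1 * A $ 1 $ 1 = 1" "Z = 2 * A $ 1 $ 1" by auto
    then have "Z\<^sup>2 = 4" by algebra
    then show False using ZR by simp
  qed
  moreover have "R \<noteq> 0" using curve by auto
  moreover have "Z \<noteq> 0"
  proof
    assume "Z = 0"
    then have "R * (R\<^sup>2 + 2 * R) = 1" using curve by algebra
    then have "inverse R = R\<^sup>2 + 2 * R" by (rule inverse_unique)
    also have "\<dots> \<in> V" using R by (intro V.closed)
    finally show False using RV by blast
  qed
  ultimately have "- 4 + 2 * R + 2 * R\<^sup>2 - R ^ 3 = 0" by (simp add: \<beta>_def)
  then have "(R - 2) * (R\<^sup>2 - 2) = 0" by algebra
  then show ?thesis by simp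
qed

end

section \<open>Hyperbolic surgeries\<close>

locale surgery_rep = knot_rep \<rho> for \<rho> +
  fixes p q :: int and h :: "word set set \<Rightarrow> mat2 set"
  assumes coeffs: "manifold_coeffs p q \<or> orbifold_coeffs p q"
    and holonomy: "hyperbolic_holonomy p q h"
    and lift: "\<And>g. g \<in> carrier knot_group \<Longrightarrow> pm_one #>\<^bsub>SL2C\<^esub> \<rho> g = h (surgery_proj p q g)"
    and curve: "R ^ 3 - R\<^sup>2 * Z\<^sup>2 + 2 * R\<^sup>2 - 1 = 0"
begin

abbreviation "S \<equiv> surgery_group p q"
abbreviation "proj \<equiv> surgery_proj p q"

lemma closed: "meridian \<in> carrier knot_group" "longitude \<in> carrier knot_group"
  "word_class u \<in> carrier knot_group"
  by (auto simp: carrier_knot_group meridian_def longitude_def)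

definition relator where
  "relator = meridian [^]\<^bsub>knot_group\<^esub> p \<otimes>\<^bsub>knot_group\<^esub> longitude [^]\<^bsub>knot_group\<^esub> q"

lemma relator_closed: "relator \<in> carrier knot_group"
  using closed by (simp add: relator_def)

lemma conjugates_subset:
  "{g \<otimes>\<^bsub>knot_group\<^esub> s \<otimes>\<^bsub>knot_group\<^esub> inv\<^bsub>knot_group\<^esub> g | g s. g \<in> carrier knot_group \<and> s \<in> {relator}}
    \<subseteq> carrier knot_group"
  using relator_closed by auto

lemma kernel_eq: "surgery_kernel p q = generate knot_group
  {g \<otimes>\<^bsub>knot_group\<^esub> s \<otimes>\<^bsub>knot_group\<^esub> inv\<^bsub>knot_group\<^esub> g | g s. g \<in> carrier knot_group \<and> s \<in> {relator}}"
  by (simp add: surgery_kernel_def normal_closure_def relator_def)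

lemma kernel_normal: "surgery_kernel p q \<lhd> knot_group"
  unfolding kernel_eq
proof (rule G.normal_generateI[OF conjugates_subset])
  fix x g
  assume "x \<in> {g \<otimes>\<^bsub>knot_group\<^esub> s \<otimes>\<^bsub>knot_group\<^esub> inv\<^bsub>knot_group\<^esub> g | g s. g \<in> carrier knot_group \<and> s \<in> {relator}}"
    and g: "g \<in> carrier knot_group"
  then obtain k where k: "k \<in> carrier knot_group"
    and x: "x = k \<otimes>\<^bsub>knot_group\<^esub> relator \<otimes>\<^bsub>knot_group\<^esub> inv\<^bsub>knot_group\<^esub> k" by auto
  have "g \<otimes>\<^bsub>knot_group\<^esub> x \<otimes>\<^bsub>knot_group\<^esub> inv\<^bsub>knot_group\<^esub> g
      = (g \<otimes>\<^bsub>knot_group\<^esub> k) \<otimes>\<^bsub>knot_group\<^esub> relator \<otimes>\<^bsub>knot_group\<^esub> inv\<^bsub>knot_group\<^esub> (g \<otimes>\<^bsub>knot_group\<^esub> k)"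
    using g k relator_closed by (simp add: x G.inv_mult_group G.m_assoc)
  then show "g \<otimes>\<^bsub>knot_group\<^esub> x \<otimes>\<^bsub>knot_group\<^esub> inv\<^bsub>knot_group\<^esub> g
      \<in> {g \<otimes>\<^bsub>knot_group\<^esub> s \<otimes>\<^bsub>knot_group\<^esub> inv\<^bsub>knot_group\<^esub> g | g s. g \<in> carrier knot_group \<and> s \<in> {relator}}"
    using g k by blast
qed

lemma relator_in_kernel: "relator \<in> surgery_kernel p q"
  unfolding kernel_eq
proof (rule generate.incl)
  have "relator = \<one>\<^bsub>knot_group\<^esub> \<otimes>\<^bsub>knot_group\<^esub> relator \<otimes>\<^bsub>knot_group\<^esub> inv\<^bsub>knot_group\<^esub> \<one>\<^bsub>knot_group\<^esub>"
    using relator_closed by simp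
  then show "relator \<in> {g \<otimes>\<^bsub>knot_group\<^esub> s \<otimes>\<^bsub>knot_group\<^esub> inv\<^bsub>knot_group\<^esub> g | g s. g \<in> carrier knot_group \<and> s \<in> {relator}}"
    by blast
qed

lemma group_S: "group S"
  unfolding surgery_group_def by (rule normal.factorgroup_is_group[OF kernel_normal])

lemma proj_closed: "g \<in> carrier knot_group \<Longrightarrow> proj g \<in> carrier S"
  by (auto simp: surgery_group_def surgery_proj_def carrier_FactGroup)

lemma proj_mult: "g \<in> carrier knot_group \<Longrightarrow> k \<in> carrier knot_group \<Longrightarrow>
    proj g \<otimes>\<^bsub>S\<^esub> proj k = proj (g \<otimes>\<^bsub>knot_group\<^esub> k)"
  by (simp add: surgery_group_def surgery_proj_def normal.rcos_sum[OF kernel_normal])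

lemma proj_one: "proj \<one>\<^bsub>knot_group\<^esub> = \<one>\<^bsub>S\<^esub>"
  using G.coset_mult_one[OF subgroup.subset[OF normal_imp_subgroup[OF kernel_normal]]]
  by (simp add: surgery_group_def surgery_proj_def)

text \<open>Faithfulness of \<open>h\<close>: triviality in the surgery group can be read off from
  \<open>\<rho>\<close> up to sign.\<close>

lemma proj_eq_one_iff:
  assumes "g \<in> carrier knot_group"
  shows "proj g = \<one>\<^bsub>S\<^esub> \<longleftrightarrow> \<rho> g \<in> pm_one"
proof -
  have "inj_on h (carrier S)" using holonomy by (simp add: hyperbolic_holonomy_def)
  then have "proj g = \<one>\<^bsub>S\<^esub> \<longleftrightarrow> h (proj g) = h (proj \<one>\<^bsub>knot_group\<^esub>)"
    unfolding proj_one[symmetric] using assms proj_closed by (auto simp: inj_on_eq_iff)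
  also have "\<dots> \<longleftrightarrow> \<rho> g \<in> pm_one"
    using pm_one_rcos_eq[of "\<rho> g"] lift[OF assms] lift[of "\<one>\<^bsub>knot_group\<^esub>"] by (simp add: pm_one_def)
  finally show ?thesis .
qed

lemma relator_rep: "A [^]\<^bsub>SL2C\<^esub> p ** \<rho> longitude [^]\<^bsub>SL2C\<^esub> q \<in> pm_one"
proof -
  have "proj relator = \<one>\<^bsub>S\<^esub>"
    using G.coset_join2[OF relator_closed normal_imp_subgroup[OF kernel_normal] relator_in_kernel]
    by (simp add: surgery_group_def surgery_proj_def)
  then have "\<rho> relator \<in> pm_one" using proj_eq_one_iff[OF relator_closed] by simp
  then show ?thesis
    using closed by (simp add: relator_def hom_int_pow A_def \<phi>_def meridian_def)
qed

section \<open>Elliptic values and isotropy groups\<close>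

lemma fixed_point_isotropy:
  assumes "g \<in> carrier knot_group" "trace (\<rho> g) = of_real \<tau>" "\<bar>\<tau>\<bar> < 2"
  obtains x where "x \<in> H3" "proj g \<in> isotropy p q h x"
proof -
  have "det (\<rho> g) = 1" using hom_closed[OF assms(1)] by simp
  from elliptic_fixed_point[OF this assms(2,3)]
  obtain x where x: "x \<in> H3" "SL2C_act (\<rho> g) x = x" by blast
  have "proj g \<in> isotropy p q h x"
    using proj_closed[OF assms(1)] x(2) PSL2C_act_rcos[of "\<rho> g" x] lift[OF assms(1)]
    by (simp add: isotropy_def)
  then show ?thesis using that x by blast
qed

lemma trace_square: "det X = 1 \<Longrightarrow> trace (X ** X) = (trace X)\<^sup>2 - 2" for X :: mat2
  unfolding det_2 trace_mat2 mat2_mult_nth by algebra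

lemma trace_pm_one: "X \<in> pm_one \<Longrightarrow> trace X = 2 \<or> trace X = - 2"
  by (auto simp: pm_one_def trace_mat2 mat2_one_nth)

lemma elliptic_nontrivial:
  assumes "g \<in> carrier knot_group" "trace (\<rho> g) = of_real \<tau>" "\<bar>\<tau>\<bar> < 2"
  shows "proj g \<noteq> \<one>\<^bsub>S\<^esub>"
proof
  assume "proj g = \<one>\<^bsub>S\<^esub>"
  then have "of_real \<tau> = (2 :: complex) \<or> of_real \<tau> = (- 2 :: complex)"
    using proj_eq_one_iff[OF assms(1)] trace_pm_one assms(2) by metis
  then have "\<tau> = 2 \<or> \<tau> = - 2" by (metis of_real_eq_iff of_real_minus of_real_numeral)
  then show False using assms(3) by auto
qed

lemma manifold_no_elliptic:
  assumes "manifold_coeffs p q" "g \<in> carrier knot_group" "trace (\<rho> g) = of_real \<tau>" "\<bar>\<tau>\<bar> < 2"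
  shows False
proof -
  obtain x where "x \<in> H3" "proj g \<in> isotropy p q h x"
    using fixed_point_isotropy assms(2-) by blast
  then have "proj g = \<one>\<^bsub>S\<^esub>"
    using holonomy assms(1) by (auto simp: hyperbolic_holonomy_def)
  then show False using elliptic_nontrivial assms(2-) by blast
qed

text \<open>For \<open>Z = 0\<close> the meridian has order 2 and \<open>ab\<^sup>-\<^sup>1\<close> is elliptic of order 3 or 5, whereas all
  isotropy groups are trivial or conjugate to the one generated by the meridian.\<close>

lemma Z_nonzero: "Z \<noteq> 0"
proof
  assume Z0: "Z = 0"
  define u where "u = word_class [la, lB]"
  have u: "u \<in> carrier knot_group" by (simp add: u_def carrier_knot_group)
  have tr_u: "trace (\<rho> u) = R" by (simp add: u_def R_def \<phi>_def)
  \<comment> \<open>At \<open>Z = 0\<close> the curve equation factors, and its roots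
    \<open>-1\<close> and \<open>(-1 \<plusminus> sqrt 5)/2\<close> are real of absolute value below
    \<open>2\<close>.\<close>
  have "(R + 1) * (R\<^sup>2 + R - 1) = R ^ 3 + 2 * R\<^sup>2 - 1" by algebra
  also have "\<dots> = 0" using curve Z0 by simp
  finally have "R + 1 = 0 \<or> R\<^sup>2 + R - 1 = 0" by simp
  then have R: "R = - 1 \<or> R\<^sup>2 + R - 1 = 0" by (auto simp: add_eq_0_iff2)
  have "\<exists>\<tau>. R = of_real \<tau> \<and> \<bar>\<tau>\<bar> < 2"
  proof (cases "R = - 1")
    case True
    then show ?thesis by (intro exI[of _ "- 1"]) simp
  next
    case False
    then have "(2 * R + 1)\<^sup>2 = 5" using R by algebra
    also have "\<dots> = (complex_of_real (sqrt 5))\<^sup>2" by (simp flip: of_real_power)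
    finally have "2 * R + 1 = of_real (sqrt 5) \<or> 2 * R + 1 = - of_real (sqrt 5)"
      by (simp only: power2_eq_iff)
    then have "R = of_real ((sqrt 5 - 1) / 2) \<or> R = of_real ((- sqrt 5 - 1) / 2)"
      by (auto simp: field_simps eq_diff_eq)
    moreover have "\<bar>(s - 1) / 2\<bar> < 2 \<and> \<bar>(- s - 1) / 2\<bar> < 2" if "s < 3" "0 < s" for s :: real
      using that by (auto simp: abs_less_iff field_simps)
    moreover have "sqrt 5 < 3" "sqrt 5 > 0" by (auto intro: real_less_lsqrt)
    ultimately show ?thesis by blast
  qed
  then obtain \<tau> where tau: "trace (\<rho> u) = of_real \<tau>" "\<bar>\<tau>\<bar> < 2" using tr_u by auto
  show False
  proof (cases "manifold_coeffs p q")
    case True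
    then show False using manifold_no_elliptic u tau by blast
  next
    case False
    then have orb: "orbifold_coeffs p q" using coeffs by simp
    interpret S: group S by (rule group_S)
    obtain x where x: "x \<in> H3" "proj u \<in> isotropy p q h x"
      using fixed_point_isotropy u tau by blast
    have "isotropy p q h x = {\<one>\<^bsub>S\<^esub>} \<or> (\<exists>g\<in>carrier S. isotropy p q h x =
        {g \<otimes>\<^bsub>S\<^esub> y \<otimes>\<^bsub>S\<^esub> inv\<^bsub>S\<^esub> g | y. y \<in> generate S {proj meridian}})"
      using holonomy orb x(1) unfolding hyperbolic_holonomy_def by blast
    moreover have "proj u \<noteq> \<one>\<^bsub>S\<^esub>" using elliptic_nontrivial u tau by blast
    ultimately obtain g y where g: "g \<in> carrier S" and y: "y \<in> generate S {proj meridian}"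
      and pu: "proj u = g \<otimes>\<^bsub>S\<^esub> y \<otimes>\<^bsub>S\<^esub> inv\<^bsub>S\<^esub> g" using x(2) by blast
    have M: "proj meridian \<in> carrier S" using closed proj_closed by blast
    \<comment> \<open>Cayley-Hamilton with trace zero, so the meridian becomes an involution and
      generates a group of at most two elements.\<close>
    have "A ** A = Q (- 1) 0 0 0"
      using quat_mult[of 0 1 0 0 0 1 0 0] Z0 by (simp flip: quat_gens(1))
    also have "\<dots> = - mat 1" by (simp add: mat2_eq_iff quat_def mat2_one_nth)
    finally have "A ** A \<in> pm_one" by (simp add: pm_one_def)
    then have "\<rho> (meridian \<otimes>\<^bsub>knot_group\<^esub> meridian) \<in> pm_one"
      using closed by (simp add: A_def \<phi>_def meridian_def)
    then have MM: "proj meridian \<otimes>\<^bsub>S\<^esub> proj meridian = \<one>\<^bsub>S\<^esub>"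
      using proj_eq_one_iff[of "meridian \<otimes>\<^bsub>knot_group\<^esub> meridian"] closed by (simp add: proj_mult)
    have "y = \<one>\<^bsub>S\<^esub> \<or> y = proj meridian"
      using y
    proof (induction rule: generate.induct)
      case (inv k)
      then show ?case using S.inv_equality[OF MM M M] by simp
    next
      case (eng k l)
      from eng.IH show ?case by (elim disjE) (simp_all add: MM M)
    qed simp_all
    then have "y \<in> carrier S \<and> y \<otimes>\<^bsub>S\<^esub> y = \<one>\<^bsub>S\<^esub>" by (elim disjE) (simp_all add: M MM)
    then have y: "y \<in> carrier S" "y \<otimes>\<^bsub>S\<^esub> y = \<one>\<^bsub>S\<^esub>" by simp_all
    \<comment> \<open>A conjugate of an element of that group squares to the identity. So
      \<open>R^2 - 2\<close>, the trace of the square, would be \<open>2\<close> or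
      \<open>-2\<close>, which none of the roots allows.\<close>
    have "proj (u \<otimes>\<^bsub>knot_group\<^esub> u) = proj u \<otimes>\<^bsub>S\<^esub> proj u" using u by (simp add: proj_mult)
    also have "\<dots> = g \<otimes>\<^bsub>S\<^esub> (y \<otimes>\<^bsub>S\<^esub> (inv\<^bsub>S\<^esub> g \<otimes>\<^bsub>S\<^esub> g) \<otimes>\<^bsub>S\<^esub> y) \<otimes>\<^bsub>S\<^esub> inv\<^bsub>S\<^esub> g"
      unfolding pu using g y(1) by (simp only: S.m_assoc S.m_closed S.inv_closed)
    also have "\<dots> = \<one>\<^bsub>S\<^esub>" using g y by simp
    finally have "\<rho> u ** \<rho> u \<in> pm_one"
      using proj_eq_one_iff[of "u \<otimes>\<^bsub>knot_group\<^esub> u"] u by simp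
    then have "trace (\<rho> u ** \<rho> u) = 2 \<or> trace (\<rho> u ** \<rho> u) = - 2" by (rule trace_pm_one)
    moreover have "trace (\<rho> u ** \<rho> u) = R\<^sup>2 - 2"
      using trace_square[of "\<rho> u"] hom_closed[OF u] tr_u by simp
    ultimately have "R\<^sup>2 = 4 \<or> R\<^sup>2 = 0" by (auto simp: diff_eq_eq)
    then show False using R
    proof (elim disjE)
      assume "R\<^sup>2 = 4" "R\<^sup>2 + R - 1 = 0"
      then have "R + 3 = 0" by (simp add: add.commute)
      then have "R = - 3" by (simp add: eq_neg_iff_add_eq_0)
      then show False using \<open>R\<^sup>2 = 4\<close> by simp
    qed auto
  qed
qed

text \<open>\<open>p = 0\<close> rules out the orbifolds and forces \<open>q = 1\<close> or
  \<open>q = -1\<close> by coprimality, so the relator is the longitude or its inverse.\<close>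

lemma no_pole_valuation:
  assumes V: "valuation_ring V" and RV: "inverse R \<notin> V"
  shows "manifold_coeffs p q" "R = 2 \<or> R\<^sup>2 = 2"
proof -
  have p: "p = 0" by (rule slope_zero[OF curve V RV relator_rep])
  then show "manifold_coeffs p q" using coeffs by (auto simp: orbifold_coeffs_def)
  then have "q = 1 \<or> q = - 1" using p by (auto simp: manifold_coeffs_def abs_if split: if_splits)
  moreover have det: "det (\<rho> longitude) = 1" using hom_closed[OF closed(2)] by simp
  moreover have "inv\<^bsub>SL2C\<^esub> (\<rho> longitude) \<in> pm_one \<Longrightarrow> \<rho> longitude \<in> pm_one"
    unfolding inv_SL2C[OF det] by (auto simp: pm_one_def mat2_eq_iff mat2_one_nth)
  ultimately have "\<rho> longitude \<in> pm_one"
    using relator_rep hom_closed[OF closed(2)] unfolding p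
    by (auto simp: H.int_pow_neg simp del: SL2C_simps(1)) 
  then show "R = 2 \<or> R\<^sup>2 = 2" by (rule zero_surgery[OF curve V RV])
qed

text \<open>Each exceptional value yields a forbidden elliptic element: the meridian for
  \<open>R = 2\<close>, where \<open>Z^2 = 15/4\<close>, and \<open>a b^-1\<close> for
  \<open>R^2 = 2\<close>.\<close>

lemma inverse_R_in_valuation_ring:
  assumes V: "valuation_ring V"
  shows "inverse R \<in> V"
proof (rule ccontr)
  assume RV: "inverse R \<notin> V"
  note mfd = no_pole_valuation[OF V RV]
  from mfd(2) show False
  proof
    assume R2: "R = 2"
    have "(2 * Z)\<^sup>2 = 15" using curve unfolding R2 by (simp add: power2_eq_square)
    also have "\<dots> = (complex_of_real (sqrt 15))\<^sup>2" by (simp flip: of_real_power)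
    finally have "2 * Z = of_real (sqrt 15) \<or> 2 * Z = - of_real (sqrt 15)"
      by (simp only: power2_eq_iff)
    then have "Z = of_real (sqrt 15 / 2) \<or> Z = of_real (- sqrt 15 / 2)"
      by (auto simp: field_simps)
    moreover have "sqrt 15 < 4" "sqrt 15 > 0" by (auto intro: real_less_lsqrt)
    then have "\<bar>sqrt 15 / 2\<bar> < 2" "\<bar>- sqrt 15 / 2\<bar> < 2" by auto
    moreover have "trace (\<rho> meridian) = Z" by (simp add: Z_def A_def \<phi>_def meridian_def)
    ultimately show False using manifold_no_elliptic[OF mfd(1) closed(1)] by metis
  next
    assume "R\<^sup>2 = 2"
    also have "\<dots> = (complex_of_real (sqrt 2))\<^sup>2" by (simp flip: of_real_power)
    finally have "R = of_real (sqrt 2) \<or> R = of_real (- sqrt 2)"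
      by (simp only: power2_eq_iff of_real_minus)
    moreover have "sqrt 2 < 2" "sqrt 2 > 0" by (auto intro: real_less_lsqrt)
    then have "\<bar>sqrt 2\<bar> < 2" "\<bar>- sqrt 2\<bar> < 2" by auto
    moreover have "trace (\<rho> (word_class [la, lB])) = R" by (simp add: R_def \<phi>_def)
    ultimately show False using manifold_no_elliptic[OF mfd(1) closed(3)] by metis
  qed
qed

section \<open>Algebraicity and infinite order\<close>

lemma R_nonzero: "R \<noteq> 0"
  using curve by auto

lemma on_E_point: "on_E R (R * Z)"
  unfolding on_E_def using curve by algebra

text \<open>A transcendental \<open>R\<close> would lie in the maximal ideal at some place.\<close>

lemma algebraic_R: "algebraic R"
  using valuation_ring_transcendental[of R] inverse_R_in_valuation_ring by blast

text \<open>Otherwise \<open>R Z\<close> has a pole at a place containing the rationals. But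
  \<open>R\<close>, being algebraic, is integral there, and \<open>R Z\<close> is a root of a monic
  quadratic over that valuation ring.\<close>

lemma algebraic_RZ: "algebraic (R * Z)"
proof (rule ccontr)
  assume *: "\<not> algebraic (R * Z)"
  then have "\<not> algebraic (inverse (R * Z))" using algebraic_inverse by fastforce
  then obtain V where V: "valuation_ring V" "\<rat> \<subseteq> V" "R * Z \<notin> V"
    using valuation_ring_transcendental by (metis inverse_inverse_eq)
  interpret valuation_ring V by fact
  have "R \<in> V" using algebraic_mem_valuation_ring[OF V(1,2) algebraic_R] .
  then have c: "1 - R ^ 3 - 2 * R\<^sup>2 \<in> V" by (intro closed)
  have "R * Z \<in> V"
  proof (rule integrally_closed)
    let ?p = "[: 1 - R ^ 3 - 2 * R\<^sup>2, 0, 1 :]"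
    show "lead_coeff ?p = 1" by simp
    show "\<forall>i. coeff ?p i \<in> V" using c zero_closed one_closed
      by (auto simp: coeff_pCons split: nat.splits)
    show "poly ?p (R * Z) = 0"
      using on_E_point by (simp add: on_E_def power2_eq_square algebra_simps)
  qed
  then show False using V by simp
qed

text \<open>One place above \<open>2\<close> suffices: torsion would exclude \<open>1/R\<close> from
  its valuation ring, while \<open>inverse_R_in_valuation_ring\<close> puts it there.\<close>

theorem infinite_order: "infinite_order_in (ec_group Qbar) (C_to_E (R, Z))"
proof -
  have "C_to_E (R, Z) \<in> carrier (ec_group Qbar)"
    using algebraic_R algebraic_RZ on_E_point by (simp add: C_to_E_def ec_group_def Qbar_def on_E_def)
  moreover have "ec_mult n (Affine R (R * Z)) \<noteq> Infinity" if "n > 0" for n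
  proof
    assume "ec_mult n (Affine R (R * Z)) = Infinity"
    moreover obtain V :: "complex set" where "valuation_ring V" "inverse 2 \<notin> V"
      using valuation_ring_over_2 by blast
    ultimately show False
      using torsion_inverse_x_notin_valuation_ring[OF on_E_point] R_nonzero Z_nonzero that
        inverse_R_in_valuation_ring by (metis mult_eq_0_iff)
  qed
  ultimately show ?thesis
    by (simp add: infinite_order_in_def pow_ec_group C_to_E_def) (simp add: ec_group_def)
qed

end

theorem theorem1p3:
  fixes P :: ec_point
  assumes "P \<in> surgery_points_E"
  shows "infinite_order_in (ec_group Qbar) P"
proof -
  obtain \<rho> p q h where P: "P = C_to_E (char_point \<rho>)"
    and rep: "manifold_coeffs p q \<or> orbifold_coeffs p q" "\<rho> \<in> hom knot_group SL2C"
      "hyperbolic_holonomy p q h" "char_point \<rho> \<in> canonical_curve"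
      "\<forall>g\<in>carrier knot_group. pm_one #>\<^bsub>SL2C\<^esub> \<rho> g = h (surgery_proj p q g)"
    using assms unfolding surgery_points_E_def surgery_points_C_def hyperbolic_surgery_rep_def by blast
  interpret knot_rep \<rho> by unfold_locales (rule rep(2))
  interpret surgery_rep \<rho> p q h
    by unfold_locales (use rep in \<open>auto simp: char_point_eq canonical_curve_def\<close>)
  show ?thesis using infinite_order unfolding P char_point_eq .
qed

end
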